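(* For any $\mathscr{B}\subset\mathbb{N}$, $\eta=\mathbf{1}_{\mathcal{F}_{\mathscr{B}}}$ is a quasi-generic point for the Mirsky measure $\nu_\eta$, which is an ergodic $S$-invariant measure on $\{0,1\}^{\mathbb{Z}}$. In particular, $\nu_\eta(X_\eta)=1$. Moreover, if $\mathscr{B}$ is Besicovitch then $\eta$ is generic for $\nu_\eta$.
   Context: $\mathbb{N}=\{1,2,\dots\}$. For $\mathscr{B}\subset\mathbb{N}$ let $\mathcal{M}_{\mathscr{B}}:=\bigcup_{b\in\mathscr{B}}b\mathbb{Z}$, $\mathcal{F}_{\mathscr{B}}:=\mathbb{Z}\setminus\mathcal{M}_{\mathscr{B}}$; $\eta\in\{0,1\}^{\mathbb{Z}}$ is the characteristic function of $\mathcal{F}_{\mathscr{B}}$. $S$ is the left shift on $\{0,1\}^{\mathbb{Z}}$ (product topology), $(Sx)(n)=x(n+1)$, and $X_\eta$ is the closure of $\{S^m\eta : m\in\mathbb{Z}\}$. Mirsky measure: let $G$ be the closure of $\{(n \bmod b)_{b\in\mathscr{B}} : n\in\mathbb{Z}\}$ in the compact group $\prod_{b\in\mathscr{B}}\mathbb{Z}/b\mathbb{Z}$, let $\mathbb{P}$ be the normalized Haar measure of $G$, and define $\varphi\colon G\to\{0,1\}^{\mathbb{Z}}$ by $\varphi(g)(n)=1$ iff $n\not\equiv -g_b \bmod b$ for all $b\in\mathscr{B}$ (and $\varphi(g)(n)=0$ otherwise). Then $\nu_\eta:=\varphi_*(\mathbb{P})$. A point $x$ is generic for an invariant measure $\mu$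 if $\frac1N\sum_{1\le n\leq N}\delta_{S^nx}\to\mu$ weakly as $N\to\infty$, and quasi-generic for $\mu$ if there is an increasing sequence $(N_k)$ with $\frac1{N_k}\sum_{1\le n\leq N_k}\delta_{S^nx}\to\mu$ weakly. $\mathscr{B}$ is Besicovitch if the density $d(\mathcal{M}_{\mathscr{B}})=\lim_{N\to\infty}\frac1N|\mathcal{M}_{\mathscr{B}}\cap[1,N]|$ exists. *)

theory Defs
  imports
    "HOL-Probability.Probability"
    "HOL-Algebra.Elementary_Groups"
    "HOL-Algebra.Product_Groups"
    "HOL-Number_Theory.Cong"
begin

text \<open>
  The positive integers are rendered as naturals, so a set \<open>B\<close> of positive integers is a
  \<open>B :: nat set\<close> with \<open>0 \<notin> B\<close>. The space of two-sided 0-1 sequences is the type \<open>int \<Rightarrow> bool\<close>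
  (\<open>True\<close> stands for 1); its type class topology is the product of the discrete topologies, and
  \<open>borel\<close> is the corresponding Borel \<open>\<sigma>\<close>-algebra.
\<close>

definition multiples :: "nat set \<Rightarrow> int set" where
  "multiples B = (\<Union>b\<in>B. {int b * k |k. True})"

definition free_set :: "nat set \<Rightarrow> int set" where
  "free_set B = UNIV - multiples B"

definition eta :: "nat set \<Rightarrow> int \<Rightarrow> bool" where
  "eta B = (\<lambda>n. n \<in> free_set B)"

definition besicovitch :: "nat set \<Rightarrow> bool" where
  "besicovitch B \<longleftrightarrow>
     convergent (\<lambda>N::nat. real (card (multiples B \<inter> {1..int N})) / real N)"

text \<open>\<open>shift_by m\<close> is the \<open>m\<close>-th iterate of the left shift, for \<open>m\<close> a possibly negative integer.\<close>

definition shift_by :: "int \<Rightarrow> (int \<Rightarrow> bool) \<Rightarrow> int \<Rightarrow> bool" where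
  "shift_by m x = (\<lambda>n. x (n + m))"

definition left_shift :: "(int \<Rightarrow> bool) \<Rightarrow> int \<Rightarrow> bool" where
  "left_shift = shift_by 1"

lemma left_shift_apply: "left_shift x n = x (n + 1)"
  by (simp add: left_shift_def shift_by_def)

lemma funpow_left_shift: "left_shift ^^ n = shift_by (int n)"
  by (induction n) (auto simp: fun_eq_iff left_shift_def shift_by_def algebra_simps)

lemma inv_left_shift: "inv_into UNIV left_shift = shift_by (- 1)"
  by (rule inv_unique_comp) (auto simp: fun_eq_iff left_shift_def shift_by_def)

definition X_eta :: "nat set \<Rightarrow> (int \<Rightarrow> bool) set" where
  "X_eta B = closure (range (\<lambda>m. shift_by m (eta B)))"

text \<open>
  The ambient compact group is \<open>product_group B integer_mod_group\<close>, whose elements are extensional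
  functions on \<open>B\<close> with \<open>g b \<in> {0..<int b}\<close>; it carries the product of the discrete topologies.
\<close>

definition residue_topology :: "nat set \<Rightarrow> (nat \<Rightarrow> int) topology" where
  "residue_topology B =
     product_topology (\<lambda>b. discrete_topology (carrier (integer_mod_group b))) B"

definition G_set :: "nat set \<Rightarrow> (nat \<Rightarrow> int) set" where
  "G_set B = residue_topology B closure_of range (\<lambda>n. \<lambda>b\<in>B. n mod int b)"

definition G_group :: "nat set \<Rightarrow> (nat \<Rightarrow> int) monoid" where
  "G_group B = (product_group B integer_mod_group)\<lparr>carrier := G_set B\<rparr>"

definition G_topology :: "nat set \<Rightarrow> (nat \<Rightarrow> int) topology" where
  "G_topology B = subtopology (residue_topology B) (G_set B)"

text \<open>
  Translation-invariant Borel probability measures. The groups \<open>G_group B\<close> are compact and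
  metrizable, hence regularity of the measure is automatic and is not demanded here.
\<close>

definition is_normalized_haar ::
    "('a, 'b) monoid_scheme \<Rightarrow> 'a topology \<Rightarrow> 'a measure \<Rightarrow> bool" where
  "is_normalized_haar G T P \<longleftrightarrow>
     prob_space P \<and>
     space P = carrier G \<and>
     sets P = sigma_sets (carrier G) {U. openin T U} \<and>
     (\<forall>g\<in>carrier G. \<forall>A\<in>sets P. emeasure P ((\<lambda>x. g \<otimes>\<^bsub>G\<^esub> x) ` A) = emeasure P A)"

definition haar_measure :: "nat set \<Rightarrow> (nat \<Rightarrow> int) measure" where
  "haar_measure B = (THE P. is_normalized_haar (G_group B) (G_topology B) P)"

definition mirsky_map :: "nat set \<Rightarrow> (nat \<Rightarrow> int) \<Rightarrow> int \<Rightarrow> bool" where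
  "mirsky_map B g = (\<lambda>n. \<forall>b\<in>B. \<not> [n = - g b] (mod int b))"

definition mirsky_measure :: "nat set \<Rightarrow> (int \<Rightarrow> bool) measure" where
  "mirsky_measure B = distr (haar_measure B) borel (mirsky_map B)"

definition invariant_measure ::
    "('a::topological_space \<Rightarrow> 'a) \<Rightarrow> 'a measure \<Rightarrow> bool" where
  "invariant_measure S M \<longleftrightarrow>
     prob_space M \<and> sets M = sets borel \<and> S \<in> measurable M M \<and>
     (\<forall>A\<in>sets M. emeasure M (S -` A) = emeasure M A)"

definition ergodic_measure ::
    "('a::topological_space \<Rightarrow> 'a) \<Rightarrow> 'a measure \<Rightarrow> bool" where
  "ergodic_measure S M \<longleftrightarrow>
     invariant_measure S M \<and>
     (\<forall>A\<in>sets M. S -` A = A \<longrightarrow> measure M A = 0 \<or> measure M A = 1)"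

text \<open>
  The average of the Dirac measures at \<open>S x, \<dots>, S\<^sup>N x\<close>, for \<open>N \<ge> 1\<close>, as the law of \<open>S\<^sup>n x\<close> for
  \<open>n\<close> uniformly distributed on \<open>{1..N}\<close>.
\<close>

definition empirical_measure ::
    "('a::topological_space \<Rightarrow> 'a) \<Rightarrow> 'a \<Rightarrow> nat \<Rightarrow> 'a measure" where
  "empirical_measure S x N =
     distr (uniform_count_measure {1..N}) borel (\<lambda>n. (S ^^ n) x)"

lemma emeasure_empirical_measure:
  assumes "N \<ge> 1" and "A \<in> sets borel"
  shows "emeasure (empirical_measure S x N) A =
    ennreal ((\<Sum>n = 1..N. indicator A ((S ^^ n) x)) / real N)"
proof -
  let ?C = "(\<lambda>n. (S ^^ n) x) -` A \<inter> {1..N}"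
  have "emeasure (empirical_measure S x N) A = emeasure (uniform_count_measure {1..N}) ?C"
    using assms unfolding empirical_measure_def
    by (subst emeasure_distr) (auto simp: space_uniform_count_measure)
  also have "\<dots> = ennreal (real (card ?C) / real N)"
    by (subst emeasure_uniform_count_measure) auto
  also have "real (card ?C) = (\<Sum>n = 1..N. indicator A ((S ^^ n) x))"
    by (simp add: indicator_def sum.If_cases Int_def conj_commute)
  finally show ?thesis .
qed

definition weakly_converges ::
    "(nat \<Rightarrow> 'a::topological_space measure) \<Rightarrow> 'a measure \<Rightarrow> bool" where
  "weakly_converges Ms M \<longleftrightarrow>
     (\<forall>f :: 'a \<Rightarrow> real. continuous_on UNIV f \<and> bounded (range f) \<longrightarrow>
        (\<lambda>k. integral\<^sup>L (Ms k) f) \<longlonglongrightarrow> integral\<^sup>L M f)"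

definition generic_point ::
    "('a::topological_space \<Rightarrow> 'a) \<Rightarrow> 'a \<Rightarrow> 'a measure \<Rightarrow> bool" where
  "generic_point S x M \<longleftrightarrow>
     invariant_measure S M \<and> weakly_converges (empirical_measure S x) M"

definition quasi_generic_point ::
    "('a::topological_space \<Rightarrow> 'a) \<Rightarrow> 'a \<Rightarrow> 'a measure \<Rightarrow> bool" where
  "quasi_generic_point S x M \<longleftrightarrow>
     invariant_measure S M \<and>
     (\<exists>N :: nat \<Rightarrow> nat. strict_mono N \<and> (\<forall>k. 1 \<le> N k) \<and>
        weakly_converges (\<lambda>k. empirical_measure S x (N k)) M)"

end

theory Submission
  imports Defs
begin

text \<open>
  Let \<open>B\<^sub>K\<close> be the set of the elements of \<open>B\<close> up to \<open>K\<close>. The point \<open>eta (B\<^sub>K)\<close> is periodic, so it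
  is generic for the uniform measure on its orbit, and everything comes from comparing \<open>eta B\<close>
  with these periodic points, once on the side of the measure and once on the side of the orbit.

  For the measure, write a random profinite integer in the factorial number system, with
  independent uniform digits \<open>w j \<in> {0..j}\<close>. Its residue modulo \<open>K!\<close> is uniform, and its residues
  modulo the elements of \<open>B\<close> are a random element of \<open>G\<close> whose law gives equal mass to all
  cylinders of a given level. A finite measure on \<open>G\<close> which is invariant under translation by the
  image of 1 is determined by its total mass, because the cylinders of level \<open>K\<close> are permuted
  transitively by this translation and hence get equal mass. So the law is the Haar measure
  (\<open>haar_measure_eq\<close>), and the same uniqueness, applied to the restriction of the Haar measure to an
  invariant set, gives ergodicity (\<open>digit_haar_ergodic\<close>). The image of the random element under
  \<open>mirsky_map\<close> is the pointwise limit of uniformly distributed points on the orbits of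
  \<open>eta (B\<^sub>K)\<close>; hence integrals against the Mirsky measure are limits of the orbit averages of the
  periodic points (\<open>integral_trunc_tendsto\<close>).

  For the orbit, the free set of \<open>B\<close> is contained in the free set of \<open>B\<^sub>K\<close>, and the number of \<open>n \<le> N\<close>
  at which the two differ is the difference of the counting functions. If along a sequence of \<open>N\<close> the
  relative frequency of the free set of \<open>B\<close> tends to \<open>d = lim d\<^sub>K\<close>, where \<open>d\<^sub>K\<close> is the density
  of the free set of \<open>B\<^sub>K\<close>, then along this sequence \<open>eta B\<close> and \<open>eta (B\<^sub>K)\<close> differ only on a set of
  density \<open>d\<^sub>K - d\<close>, which tends to 0, and the empirical measures converge to the Mirsky measure
  (\<open>weakly_converges_along\<close>). A continuous function on the compact space of 0-1 sequences depends,
  up to a small error, on a finite window only, which is what allows this comparison.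

  That such a sequence exists is the theorem of Davenport and Erdos (\<open>davenport_erdos\<close>): the upper
  density of the free set of \<open>B\<close> is \<open>d\<close>, although its lower density may be smaller. The reason is that
  for a divisor-closed set \<open>F\<close> the quotient of \<open>\<Sum>n\<in>F. n\<^sup>-\<^sup>s\<close> by \<open>\<zeta>(s)\<close> is nondecreasing in \<open>s > 1\<close>: under
  the zeta distribution the exponents of the primes are independent and become stochastically
  larger as \<open>s\<close> decreases. For the free set of \<open>B\<^sub>K\<close> the quotient tends to \<open>d\<^sub>K\<close> as \<open>s\<close> tends to 1, so it
  is at least \<open>d\<^sub>K \<ge> d\<close> for all \<open>s > 1\<close>; letting \<open>K\<close> grow with \<open>s\<close> fixed gives the bound \<open>d\<close> for the
  free set of \<open>B\<close>, which is impossible if its upper density is below \<open>d\<close>. If \<open>B\<close> is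
  Besicovitch, the density of the free set must then be \<open>d\<close>, and the comparison works along all \<open>N\<close>.

  Finally, the complement of \<open>X_eta B\<close> is a countable union of clopen sets that the orbit of \<open>eta B\<close>
  never meets, and weak convergence shows that each of them is null.
\<close>

section \<open>Dirichlet series of divisor-closed sets and the Davenport--Erdos theorem\<close>

text \<open>
  Jordan's totient function of real order \<open>u\<close>, the Dirichlet convolution of \<open>n\<^sup>u\<close> with the Moebius
  function. What matters is that \<open>n\<^sup>u\<close> is the divisor sum of a nonnegative function.
\<close>

definition real_totient :: "real \<Rightarrow> nat \<Rightarrow> real" where
  "real_totient u n = real n powr u * (\<Prod>p\<in>prime_factors n. 1 - real p powr (- u))"

lemma real_totient_nonneg:
  assumes "u > 0"
  shows "real_totient u n \<ge> 0"
proof -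
  have "real p powr (- u) \<le> 1" if "p \<in> prime_factors n" for p
  proof -
    have "p \<ge> 1" using that by (auto simp: in_prime_factors_iff prime_gt_0_nat Suc_leI)
    then show ?thesis using assms by (simp add: powr_minus inverse_le_1_iff ge_one_powr_ge_zero)
  qed
  then show ?thesis unfolding real_totient_def
    by (intro mult_nonneg_nonneg prod_nonneg) auto
qed

lemma real_totient_prime_mult:
  assumes "prime p" "d > 0"
  shows "real_totient u (p * d) =
    (if p dvd d then real p powr u else real p powr u - 1) * real_totient u d"
proof -
  have pf: "prime_factors (p * d) = insert p (prime_factors d)"
    using assms by (simp add: prime_factors_product prime_factorization_prime)
  have p0: "p > 0" using assms by (simp add: prime_gt_0_nat)
  have e: "real p powr u * (1 - real p powr (- u)) = real p powr u - 1"
    using p0 by (simp add: right_diff_distrib powr_minus field_simps)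
  show ?thesis
  proof (cases "p dvd d")
    case True
    then have "insert p (prime_factors d) = prime_factors d"
      using assms by (auto simp: in_prime_factors_iff)
    then show ?thesis using True by (simp add: real_totient_def pf powr_mult)
  next
    case False
    then have "p \<notin> prime_factors d" by (auto simp: in_prime_factors_iff)
    then have "real_totient u (p * d) =
        (real p powr u * (1 - real p powr (- u))) * real_totient u d"
      by (simp add: real_totient_def pf powr_mult)
    then show ?thesis using False e by simp
  qed
qed

text \<open>
  Induction on the number of prime factors, without splitting off a full prime power. A divisor of
  \<open>p * x\<close> is either a divisor of \<open>x\<close> prime to \<open>p\<close>, or \<open>p * e\<close> for a divisor \<open>e\<close> of \<open>x\<close>. By the previous lemma
  the two kinds together contribute \<open>p\<^sup>u\<close> times the divisor sum for \<open>x\<close>.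
\<close>

lemma sum_real_totient_divisors:
  "n > 0 \<Longrightarrow> (\<Sum>d | d dvd n. real_totient u d) = real n powr u"
proof (induction n rule: less_induct)
  case (less n)
  show ?case
  proof (cases "n = 1")
    case True
    then show ?thesis by (simp add: real_totient_def)
  next
    case False
    then obtain p where p: "prime p" "p dvd n" using prime_factor_nat by blast
    then obtain x where n: "n = p * x" by (auto elim: dvdE)
    have p0: "p > 0" using p by (simp add: prime_gt_0_nat)
    have x0: "x > 0" using less.prems n by auto
    have "x < n" using p x0 n prime_gt_1_nat[of p] by simp
    then have IH: "(\<Sum>d | d dvd x. real_totient u d) = real x powr u" using less.IH x0 by simp
    let ?D = "{d. d dvd x}"
    let ?E = "{d. d dvd x \<and> \<not> p dvd d}"
    have fin: "finite ?D" "finite ?E" using x0 by auto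
    have split: "{d. d dvd n} = ?E \<union> (\<lambda>d. p * d) ` ?D"
    proof (intro equalityI subsetI)
      fix d assume "d \<in> {d. d dvd n}"
      then have d: "d dvd p * x" by (simp add: n)
      show "d \<in> ?E \<union> (\<lambda>d. p * d) ` ?D"
      proof (cases "p dvd d")
        case True
        then obtain e where "d = p * e" by (auto elim: dvdE)
        then show ?thesis using d p0 by auto
      next
        case False
        then have "coprime d p" using p by (metis coprime_commute prime_imp_coprime)
        then have "d dvd x" using d by (simp add: coprime_dvd_mult_right_iff)
        then show ?thesis using False by simp
      qed
    qed (auto simp: n)
    have "(\<Sum>d | d dvd n. real_totient u d) =
        (\<Sum>d\<in>?E. real_totient u d) + (\<Sum>d\<in>(\<lambda>d. p * d) ` ?D. real_totient u d)"
      unfolding split using fin by (intro sum.union_disjoint) auto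
    also have "(\<Sum>d\<in>?E. real_totient u d) =
        (\<Sum>d\<in>?D. if p dvd d then 0 else real_totient u d)"
      using fin by (intro sum.mono_neutral_cong_left) auto
    also have "(\<Sum>d\<in>(\<lambda>d. p * d) ` ?D. real_totient u d) = (\<Sum>d\<in>?D. real_totient u (p * d))"
      using p0 by (subst sum.reindex) (auto simp: inj_on_def)
    also have "(\<Sum>d\<in>?D. if p dvd d then 0 else real_totient u d) + \<dots> =
        (\<Sum>d\<in>?D. (if p dvd d then 0 else real_totient u d) + real_totient u (p * d))"
      by (simp add: sum.distrib)
    also have "\<dots> = (\<Sum>d\<in>?D. real p powr u * real_totient u d)"
    proof (rule sum.cong[OF refl])
      fix d assume "d \<in> ?D"
      then have "d > 0" using x0 by (auto intro!: Nat.gr0I)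
      show "(if p dvd d then 0 else real_totient u d) + real_totient u (p * d) =
          real p powr u * real_totient u d"
        unfolding real_totient_prime_mult[OF p(1) \<open>d > 0\<close>] by (simp add: algebra_simps)
    qed
    also have "\<dots> = real n powr u"
      by (simp add: sum_distrib_left[symmetric] IH n powr_mult)
    finally show ?thesis .
  qed
qed

text \<open>
  The term for 0 vanishes because \<open>0 powr (- s) = 0\<close>, so this is the Dirichlet series
  over the positive elements of \<open>F\<close>, and \<open>dirichlet UNIV\<close> is the zeta function.
\<close>

definition dirichlet :: "nat set \<Rightarrow> real \<Rightarrow> real" where
  "dirichlet F s = (\<Sum>n. indicator F n * real n powr (- s))"

definition divisor_closed :: "nat set \<Rightarrow> bool" where
  "divisor_closed F \<longleftrightarrow> (\<forall>d m. d * m \<in> F \<longrightarrow> m \<in> F)"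

lemma dirichlet_summable:
  assumes "s > 1"
  shows "summable (\<lambda>n. indicator F n * real n powr (- s))"
proof (rule summable_comparison_test')
  show "summable (\<lambda>n. real n powr (- s))" using assms by (simp add: summable_real_powr_iff)
  show "norm (indicator F n * real n powr (- s)) \<le> real n powr (- s)" for n
    by (auto simp: indicator_def)
qed

lemma sum_le_dirichlet:
  assumes "s > 1" "finite I"
  shows "(\<Sum>n\<in>I. indicator F n * real n powr (- s)) \<le> dirichlet F s"
  unfolding dirichlet_def using assms by (intro sum_le_suminf dirichlet_summable) auto

lemma dirichlet_le:
  assumes "s > 1" "\<And>N. (\<Sum>n = 1..N. indicator F n * real n powr (- s)) \<le> C"
  shows "dirichlet F s \<le> C"
  unfolding dirichlet_def
proof (rule suminf_le_const[OF dirichlet_summable[OF assms(1)]])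
  fix N
  have "(\<Sum>n<N. indicator F n * real n powr (- s)) = (\<Sum>n\<in>{..<N} - {0}. indicator F n * real n powr (- s))"
    by (intro sum.mono_neutral_right) auto
  also have "\<dots> \<le> (\<Sum>n = 1..N. indicator F n * real n powr (- s))"
    by (intro sum_mono2) auto
  also have "\<dots> \<le> C" by (rule assms)
  finally show "(\<Sum>n<N. indicator F n * real n powr (- s)) \<le> C" .
qed

lemma dirichlet_UNIV_pos:
  assumes "s > 1"
  shows "dirichlet UNIV s > 0"
  using sum_le_dirichlet[OF assms, of "{1}" UNIV] by simp

lemma powr_eq_sum_divisors:
  assumes "n > 0"
  shows "real n powr (- t) = (\<Sum>d | d dvd n. real_totient (s - t) d * real n powr (- s))"
  using assms sum_real_totient_divisors[of n "s - t"]
  by (simp add: sum_distrib_right[symmetric] powr_add[symmetric])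

text \<open>
  Put
  \<open>u = s - t\<close> and let \<open>J\<close> be the totient of order \<open>u\<close>, so that \<open>n powr (- t)\<close> is the sum of
  \<open>J d * n powr (- s)\<close> over the divisors \<open>d\<close> of \<open>n\<close>. Write \<open>n = d * m\<close>. If \<open>n \<in> F\<close> then \<open>m \<in> F\<close>, so the
  series of \<open>F\<close> at \<open>t\<close> is at most the product of the series of \<open>J\<close> and the series of \<open>F\<close>, both at \<open>s\<close>; for
  \<open>F = UNIV\<close> this is an equality. So the quotient of the series of \<open>F\<close> by the zeta function is nondecreasing. Working with partial sums of the series of \<open>J\<close> avoids
  rearrangements of infinite sums.
\<close>

lemma dirichlet_quotient_mono:
  assumes F: "divisor_closed F" and ts: "1 < t" "t < s"
  shows "dirichlet F t * dirichlet UNIV s \<le> dirichlet F s * dirichlet UNIV t"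
proof -
  define J where "J = real_totient (s - t)"
  have J0: "J d \<ge> 0" for d using ts by (simp add: J_def real_totient_nonneg)
  define c where "c N = (\<Sum>d = 1..N. J d * real d powr (- s))" for N
  have c0: "c N \<ge> 0" for N unfolding c_def using J0 by (intro sum_nonneg) auto
  have s1: "s > 1" using ts by simp
  have F': "m \<in> F" if "d * m \<in> F" for d m using F that by (auto simp: divisor_closed_def)
  have lower: "c N * dirichlet UNIV s \<le> dirichlet UNIV t" for N
  proof (cases "c N = 0")
    case True
    then show ?thesis using dirichlet_UNIV_pos[OF ts(1)] by simp
  next
    case False
    then have c: "c N > 0" using c0[of N] by simp
    have "dirichlet UNIV s \<le> dirichlet UNIV t / c N"
    proof (rule dirichlet_le[OF s1])
      fix M
      have "c N * (\<Sum>m = 1..M. real m powr (- s)) =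
          (\<Sum>(d, m)\<in>{1..N} \<times> {1..M}. J d * real d powr (- s) * real m powr (- s))"
        by (simp add: c_def sum_product sum.cartesian_product)
      also have "\<dots> \<le> (\<Sum>(n, d)\<in>Sigma {1..N * M} (\<lambda>n. {d. d dvd n}). J d * real n powr (- s))"
      proof (rule sum_le_included[where i = "\<lambda>(n, d). (d, n div d)"])
        show "\<forall>x\<in>{1..N} \<times> {1..M}. \<exists>y\<in>Sigma {1..N * M} (\<lambda>n. {d. d dvd n}).
          (case y of (n, d) \<Rightarrow> (d, n div d)) = x \<and>
          (case x of (d, m) \<Rightarrow> J d * real d powr (- s) * real m powr (- s))
           \<le> (case y of (n, d) \<Rightarrow> J d * real n powr (- s))"
        proof clarify
          fix d m assume "d \<in> {1..N}" "m \<in> {1..M}"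
          then show "\<exists>y\<in>Sigma {1..N * M} (\<lambda>n. {d. d dvd n}).
            (case y of (n, d) \<Rightarrow> (d, n div d)) = (d, m) \<and>
            J d * real d powr (- s) * real m powr (- s) \<le> (case y of (n, d) \<Rightarrow> J d * real n powr (- s))"
            by (intro bexI[of _ "(d * m, d)"]) (auto simp: powr_mult mult_le_mono Suc_le_eq)
        qed
      qed (auto intro!: finite_SigmaI J0 mult_nonneg_nonneg)
      also have "\<dots> = (\<Sum>n = 1..N * M. real n powr (- t))"
        by (subst sum.Sigma[symmetric])
          (auto intro!: sum.cong simp: powr_eq_sum_divisors[of _ t s] J_def)
      also have "\<dots> \<le> dirichlet UNIV t"
        using sum_le_dirichlet[OF ts(1), of "{1..N * M}" UNIV] by simp
      finally show "(\<Sum>n = 1..M. indicator UNIV n * real n powr (- s)) \<le> dirichlet UNIV t / c N"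
        using c by (simp add: field_simps)
    qed
    then show ?thesis using c by (simp add: field_simps)
  qed
  have upper: "(\<Sum>n = 1..N. indicator F n * real n powr (- t)) \<le> c N * dirichlet F s" for N
  proof -
    have "(\<Sum>n = 1..N. indicator F n * real n powr (- t)) =
        (\<Sum>n = 1..N. \<Sum>d | d dvd n. indicator F n * (J d * real n powr (- s)))"
      by (intro sum.cong refl) (auto simp: powr_eq_sum_divisors[of _ t s] J_def sum_distrib_left[symmetric])
    also have "\<dots> = (\<Sum>(n, d)\<in>Sigma {1..N} (\<lambda>n. {d. d dvd n}). indicator F n * (J d * real n powr (- s)))"
      by (subst sum.Sigma) auto
    also have "\<dots> \<le> (\<Sum>(d, m)\<in>{1..N} \<times> {1..N}. (J d * real d powr (- s)) * (indicator F m * real m powr (- s)))"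
    proof (rule sum_le_included[where i = "\<lambda>(d, m). (d * m, d)"])
      show "\<forall>x\<in>Sigma {1..N} (\<lambda>n. {d. d dvd n}). \<exists>y\<in>{1..N} \<times> {1..N}.
          (case y of (d, m) \<Rightarrow> (d * m, d)) = x \<and>
          (case x of (n, d) \<Rightarrow> indicator F n * (J d * real n powr (- s)))
           \<le> (case y of (d, m) \<Rightarrow> (J d * real d powr (- s)) * (indicator F m * real m powr (- s)))"
      proof clarify
        fix n d assume n: "n \<in> {1..N}" and "d dvd n"
        then obtain m where m: "n = d * m" by (auto elim: dvdE)
        then have "0 < d" "0 < m" "d \<le> n" "m \<le> n" using n by (auto intro: Nat.gr0I)
        then show "\<exists>y\<in>{1..N} \<times> {1..N}. (case y of (d, m) \<Rightarrow> (d * m, d)) = (n, d) \<and>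
          indicator F n * (J d * real n powr (- s))
          \<le> (case y of (d, m) \<Rightarrow> (J d * real d powr (- s)) * (indicator F m * real m powr (- s)))"
          using n m F'[of d m] J0 order_trans[of d n N] order_trans[of m n N]
          by (intro bexI[of _ "(d, m)"]) (auto simp: powr_mult indicator_def)
      qed
    qed (auto intro!: finite_SigmaI J0 mult_nonneg_nonneg)
    also have "\<dots> = c N * (\<Sum>m = 1..N. indicator F m * real m powr (- s))"
      by (simp only: c_def sum_product sum.cartesian_product)
    also have "\<dots> \<le> c N * dirichlet F s"
      by (intro mult_left_mono sum_le_dirichlet[OF s1] c0) simp
    finally show ?thesis .
  qed
  have Fs0: "dirichlet F s \<ge> 0" using sum_le_dirichlet[OF s1, of "{}" F] by simp
  have "dirichlet F t \<le> dirichlet F s * dirichlet UNIV t / dirichlet UNIV s"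
  proof (rule dirichlet_le[OF ts(1)])
    fix N
    have "c N * dirichlet F s * dirichlet UNIV s \<le> dirichlet F s * dirichlet UNIV t"
      using mult_left_mono[OF lower[of N] Fs0] by (simp add: mult_ac)
    then have "c N * dirichlet F s \<le> dirichlet F s * dirichlet UNIV t / dirichlet UNIV s"
      using dirichlet_UNIV_pos[OF s1] by (simp add: field_simps)
    then show "(\<Sum>n = 1..N. indicator F n * real n powr (- t))
        \<le> dirichlet F s * dirichlet UNIV t / dirichlet UNIV s"
      using upper[of N] by linarith
  qed
  then show ?thesis using dirichlet_UNIV_pos[OF s1] by (simp add: field_simps)
qed

text \<open>
  Summation by parts; the induction carries the form with the last partial sum not yet estimated.
\<close>

lemma abel_sum_le:
  fixes a f :: "nat \<Rightarrow> real"
  assumes a: "\<And>N. (\<Sum>n = 1..N. a n) \<le> C"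
    and f: "\<And>n. f n \<ge> 0" "\<And>n. n \<ge> 1 \<Longrightarrow> f (Suc n) \<le> f n"
  shows "(\<Sum>n = 1..N. a n * f n) \<le> C * f 1"
proof (cases "N = 0")
  case True
  then show ?thesis using a[of 0] f by simp
next
  case False
  then have "N \<ge> 1" by simp
  then have "(\<Sum>n = 1..N. a n * f n) \<le> C * (f 1 - f N) + (\<Sum>n = 1..N. a n) * f N"
  proof (induction N rule: dec_induct)
    case base
    then show ?case by simp
  next
    case (step N)
    have "(\<Sum>n = 1..N. a n) * (f N - f (Suc N)) \<le> C * (f N - f (Suc N))"
      using a f step by (intro mult_right_mono) auto
    then show ?case using step by (simp add: algebra_simps)
  qed
  also have "\<dots> \<le> C * (f 1 - f N) + C * f N"
    using a f by (intro add_left_mono mult_right_mono) auto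
  finally show ?thesis by (simp add: algebra_simps)
qed

lemma powr_neg_antimono:
  assumes "s > 1" "n \<ge> (1::nat)"
  shows "real (Suc n) powr (- s) \<le> real n powr (- s)"
  using assms by (intro powr_mono2') auto

lemma sum_indicator_eq_card:
  fixes F :: "nat set"
  shows "(\<Sum>n = 1..N. indicator F n) = real (card (F \<inter> {1..N}))"
proof -
  have "real (card (F \<inter> {1..N})) = (\<Sum>n\<in>{1..N} \<inter> F. 1)" by (simp add: Int_commute)
  also have "\<dots> = (\<Sum>n = 1..N. indicator F n)"
    by (rule sum.mono_neutral_cong_left) auto
  finally show ?thesis ..
qed

text \<open>
  Summation by parts, applied to the coefficients \<open>indicator F n - c\<close>, whose partial sums are bounded
  by \<open>C\<close>, and to the weights \<open>n powr (- s)\<close>, which decrease from 1.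
\<close>

lemma dirichlet_upper_bound:
  assumes s: "s > 1" and card: "\<And>N. real (card (F \<inter> {1..N})) \<le> c * real N + C"
  shows "dirichlet F s \<le> c * dirichlet UNIV s + C"
proof -
  have key: "(\<Sum>n = 1..N. (indicator F n - c) * real n powr (- s)) \<le> C * real 1 powr (- s)" for N
  proof (rule abel_sum_le)
    show "(\<Sum>n = 1..N. indicator F n - c) \<le> C" for N
      using card[of N] by (simp only: sum_subtractf sum_indicator_eq_card) (simp add: mult.commute)
  qed (use s powr_neg_antimono in auto)
  have sm: "summable (\<lambda>n. indicator F n * real n powr (- s) - c * (indicator UNIV n * real n powr (- s)))"
    by (intro summable_diff summable_mult dirichlet_summable s)
  have "(\<Sum>n. indicator F n * real n powr (- s) - c * (indicator UNIV n * real n powr (- s))) \<le> C"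
  proof (rule LIMSEQ_le_const2)
    show "(\<lambda>N. \<Sum>n<Suc N. indicator F n * real n powr (- s) - c * (indicator UNIV n * real n powr (- s)))
        \<longlonglongrightarrow> (\<Sum>n. indicator F n * real n powr (- s) - c * (indicator UNIV n * real n powr (- s)))"
      by (rule LIMSEQ_Suc[OF summable_LIMSEQ[OF sm]])
    have "(\<Sum>n<Suc N. indicator F n * real n powr (- s) - c * (indicator UNIV n * real n powr (- s)))
        = (\<Sum>n = 1..N. (indicator F n - c) * real n powr (- s))" for N
      by (intro sum.mono_neutral_cong_right) (auto simp: algebra_simps)
    then show "\<exists>N0. \<forall>N\<ge>N0. (\<Sum>n<Suc N. indicator F n * real n powr (- s)
        - c * (indicator UNIV n * real n powr (- s))) \<le> C"
      using key by simp
  qed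
  also have "(\<Sum>n. indicator F n * real n powr (- s) - c * (indicator UNIV n * real n powr (- s)))
      = dirichlet F s - c * dirichlet UNIV s"
    using suminf_diff[OF dirichlet_summable[OF s, of F] summable_mult[OF dirichlet_summable[OF s, of UNIV], of c]]
      suminf_mult[OF dirichlet_summable[OF s, of UNIV], of c]
    by (simp only: dirichlet_def)
  finally show ?thesis by simp
qed

lemma dirichlet_complement:
  assumes "s > 1"
  shows "dirichlet (- F) s = dirichlet UNIV s - dirichlet F s"
proof -
  have "(\<lambda>n. indicator (- F) n * real n powr (- s)) =
      (\<lambda>n. indicator UNIV n * real n powr (- s) - indicator F n * real n powr (- s))"
    by (auto simp: indicator_def)
  then show ?thesis unfolding dirichlet_def using dirichlet_summable[OF assms]
    by (simp only: suminf_diff)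
qed

text \<open>
  This is the upper bound for the complement of \<open>F\<close>.
\<close>

lemma dirichlet_lower_bound:
  assumes s: "s > 1" and card: "\<And>N. c * real N - C \<le> real (card (F \<inter> {1..N}))"
  shows "c * dirichlet UNIV s - C \<le> dirichlet F s"
proof -
  have "real (card (- F \<inter> {1..N})) \<le> (1 - c) * real N + C" for N
  proof -
    have "N = card (F \<inter> {1..N}) + card (- F \<inter> {1..N})"
      by (subst card_Un_disjoint[symmetric]) (auto simp: Int_commute intro!: arg_cong[where f = card] simp flip: Int_Un_distrib2)
    then show ?thesis using card[of N] by (simp add: algebra_simps)
  qed
  from dirichlet_upper_bound[OF s this] show ?thesis
    by (simp add: dirichlet_complement[OF s] algebra_simps)
qed

text \<open>
  A finite partial sum of the divergent harmonic series is the limit of the corresponding partial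
  sums of the zeta function.
\<close>

lemma zeta_at_top: "filterlim (dirichlet UNIV) at_top (at_right 1)"
  unfolding filterlim_at_top
proof
  fix C :: real
  have "\<not> summable (\<lambda>n. real n powr (- 1))" by (simp only: summable_real_powr_iff)
  then obtain N where N: "(\<Sum>n<N. real n powr (- 1)) > C"
    using bounded_imp_summable[of "\<lambda>n. real n powr (- 1)" C]
    by (metis not_le powr_ge_zero lessThan_Suc_atMost)
  have "((\<lambda>t. \<Sum>n<N. real n powr (- t)) \<longlongrightarrow> (\<Sum>n<N. real n powr (- 1))) (at_right 1)"
  proof (intro tendsto_sum)
    fix n
    show "((\<lambda>t. real n powr (- t)) \<longlongrightarrow> real n powr (- 1)) (at_right 1)"
    proof (cases "n = 0")
      case False
      then show ?thesis
        by (intro tendsto_powr tendsto_const tendsto_minus tendsto_ident_at) simp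
    qed simp
  qed
  then have "\<forall>\<^sub>F t in at_right 1. (\<Sum>n<N. real n powr (- t)) > C"
    using N by (rule order_tendstoD)
  moreover have "\<forall>\<^sub>F t in at_right 1. (t::real) > 1" by (simp add: eventually_at_right_less)
  ultimately show "\<forall>\<^sub>F t in at_right 1. C \<le> dirichlet UNIV t"
  proof eventually_elim
    case (elim t)
    then show ?case using sum_le_dirichlet[of t "{..<N}" UNIV] by simp
  qed
qed

text \<open>
  Compare \<open>s\<close> with \<open>t\<close> close to 1: by monotonicity the quotient at \<open>s\<close> is at least the quotient at \<open>t\<close>, which
  is at least \<open>c - C / \<zeta>(t)\<close>, and \<open>\<zeta>(t)\<close> tends to infinity.
\<close>

lemma dirichlet_ge_density_mult_zeta:
  assumes F: "divisor_closed F" and s: "s > 1"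
    and card: "\<And>N. c * real N - C \<le> real (card (F \<inter> {1..N}))"
  shows "c * dirichlet UNIV s \<le> dirichlet F s"
proof -
  have "((\<lambda>t. c * dirichlet UNIV s - C / dirichlet UNIV t * dirichlet UNIV s)
      \<longlongrightarrow> c * dirichlet UNIV s - 0 * dirichlet UNIV s) (at_right 1)"
    by (intro tendsto_intros tendsto_divide_0[OF tendsto_const]
        filterlim_at_top_imp_at_infinity zeta_at_top)
  moreover have "\<forall>\<^sub>F t in at_right 1. c * dirichlet UNIV s - C / dirichlet UNIV t * dirichlet UNIV s \<le> dirichlet F s"
    using eventually_at_right_real[OF s]
  proof eventually_elim
    case (elim t)
    then have t: "1 < t" "t < s" by auto
    have p: "dirichlet UNIV t > 0" "dirichlet UNIV s > 0" using dirichlet_UNIV_pos t by auto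
    have "(c * dirichlet UNIV t - C) * dirichlet UNIV s \<le> dirichlet F t * dirichlet UNIV s"
      using dirichlet_lower_bound[OF t(1) card] p by (intro mult_right_mono) auto
    also have "\<dots> \<le> dirichlet F s * dirichlet UNIV t" by (rule dirichlet_quotient_mono[OF F t])
    finally show ?case using p by (simp add: field_simps)
  qed
  ultimately show ?thesis by (intro tendsto_upperbound[of _ _ "at_right 1"]) auto
qed

text \<open>
  The sets \<open>E K\<close> play the part of the free sets of the finite truncations of a set of moduli, and \<open>d\<close> is
  a lower bound of their densities. The passage from \<open>E K\<close> to \<open>F\<close> happens at a fixed \<open>s > 1\<close>, where the
  tail of the zeta series is small. A failure of the conclusion bounds the counting function of \<open>F\<close> by
  \<open>c * N\<close> up to a constant, hence the series of \<open>F\<close> by \<open>c * \<zeta>(s)\<close> up to a constant, and this contradicts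
  the lower bound \<open>d * \<zeta>(s)\<close> as \<open>s\<close> tends to 1.
\<close>

theorem davenport_erdos:
  assumes closed: "\<And>K. divisor_closed (E K)"
    and card: "\<And>K. \<exists>C. \<forall>N. d * real N - C \<le> real (card (E K \<inter> {1..N}))"
    and F: "\<And>K. F \<inter> {1..K} = E K \<inter> {1..K}"
    and c: "c < d"
  shows "\<exists>N\<ge>N0. c * real N < real (card (F \<inter> {1..N}))"
proof (rule ccontr)
  assume "\<not> ?thesis"
  then have le: "real (card (F \<inter> {1..N})) \<le> c * real N" if "N \<ge> N0" for N
    using that by (auto simp: not_less)
  \<comment> \<open>The constant absorbs the finitely many \<open>N < N0\<close>, also when \<open>c\<close> is negative.\<close>
  define C where "C = real N0 + \<bar>c\<bar> * real N0"
  have le': "real (card (F \<inter> {1..N})) \<le> c * real N + C" for N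
  proof (cases "N \<ge> N0")
    case True
    then show ?thesis using le[of N] by (simp add: C_def add_increasing2)
  next
    case False
    have "card (F \<inter> {1..N}) \<le> N" using card_mono[of "{1..N}" "F \<inter> {1..N}"] by simp
    moreover have "- c * real N \<le> \<bar>c\<bar> * real N0"
      using False by (intro mult_mono) auto
    ultimately show ?thesis using False by (simp add: C_def)
  qed
  have bound: "(d - c) * dirichlet UNIV s \<le> C" if s: "s > 1" for s
  proof -
    let ?z = "\<lambda>K. \<Sum>n = 1..K. indicator UNIV n * real n powr (- s)"
    \<comment> \<open>Up to \<open>K\<close> the sets agree, and beyond \<open>K\<close> they differ by at most the tail of the zeta series.\<close>
    have "d * dirichlet UNIV s \<le> dirichlet F s + (dirichlet UNIV s - ?z K)" for K
    proof -
      obtain D where D: "\<And>N. d * real N - D \<le> real (card (E K \<inter> {1..N}))" using card by blast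
      have "(\<Sum>n = 1..K. indicator (- E K) n * real n powr (- s)) \<le> dirichlet (- E K) s"
        using s by (rule sum_le_dirichlet) simp
      moreover have "(\<Sum>n = 1..K. indicator (- E K) n * real n powr (- s)) =
          ?z K - (\<Sum>n = 1..K. indicator F n * real n powr (- s))"
      proof -
        have "n \<in> F \<longleftrightarrow> n \<in> E K" if "n \<in> {1..K}" for n using F[of K] that by blast
        then show ?thesis unfolding sum_subtractf[symmetric]
          by (intro sum.cong) (auto simp: indicator_def)
      qed
      moreover have "(\<Sum>n = 1..K. indicator F n * real n powr (- s)) \<le> dirichlet F s"
        using s by (rule sum_le_dirichlet) simp
      moreover have "d * dirichlet UNIV s \<le> dirichlet (E K) s"
        by (rule dirichlet_ge_density_mult_zeta[OF closed s D])
      ultimately show ?thesis by (simp add: dirichlet_complement[OF s])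
    qed
    moreover have "(\<lambda>K. dirichlet F s + (dirichlet UNIV s - ?z K))
        \<longlonglongrightarrow> dirichlet F s + (dirichlet UNIV s - dirichlet UNIV s)"
    proof -
      have "(\<lambda>K. \<Sum>n<Suc K. indicator UNIV n * real n powr (- s)) \<longlonglongrightarrow> dirichlet UNIV s"
        unfolding dirichlet_def by (rule LIMSEQ_Suc[OF summable_LIMSEQ[OF dirichlet_summable[OF s]]])
      moreover have "(\<Sum>n<Suc K. indicator UNIV n * real n powr (- s)) = ?z K" for K
        by (intro sum.mono_neutral_cong_right) auto
      ultimately have "?z \<longlonglongrightarrow> dirichlet UNIV s" by simp
      then show ?thesis by (intro tendsto_intros)
    qed
    ultimately have "d * dirichlet UNIV s \<le> dirichlet F s + (dirichlet UNIV s - dirichlet UNIV s)"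
      by (intro LIMSEQ_le_const) auto
    also have "\<dots> \<le> c * dirichlet UNIV s + C" using dirichlet_upper_bound[OF s le'] by simp
    finally show ?thesis by (simp add: algebra_simps)
  qed
  have "\<forall>\<^sub>F s in at_right 1. dirichlet UNIV s > C / (d - c)"
    using zeta_at_top by (simp add: filterlim_at_top_dense)
  moreover have "\<forall>\<^sub>F s in at_right 1. (s::real) > 1" by (simp add: eventually_at_right_less)
  ultimately have "\<forall>\<^sub>F s in at_right (1::real). False"
  proof eventually_elim
    case (elim s)
    then show ?case using bound[of s] c by (simp add: field_simps)
  qed
  then show False by simp
qed

section \<open>Sums of functions on the integers over long intervals\<close>

text \<open>
  Shifting by one removes one value and adds the value one period later.
\<close>

lemma periodic_sum_shift:
  fixes p :: "int \<Rightarrow> real"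
  assumes p: "\<And>z. p (z + int L) = p z"
  shows "(\<Sum>v<L. p (int v + m)) = (\<Sum>v<L. p (int v))"
proof -
  have step: "(\<Sum>v<L. p (int v + (m + 1))) = (\<Sum>v<L. p (int v + m))" for m
  proof -
    have "(\<Sum>v<L. p (int v + (m + 1))) + p m = (\<Sum>v<Suc L. p (int v + m))"
      by (subst sum.lessThan_Suc_shift) (simp add: ac_simps)
    then show ?thesis using p[of m] by (simp add: add.commute)
  qed
  show ?thesis
  proof (induction m rule: int_induct[of _ 0])
    case (step2 i)
    then show ?case using step[of "i - 1"] by simp
  qed (simp_all add: step)
qed

lemma sum_shift_le:
  fixes g :: "int \<Rightarrow> real"
  assumes g: "\<And>z. 0 \<le> g z" "\<And>z. g z \<le> 1"
  shows "(\<Sum>n = 1..N. g (int n + i)) \<le> (\<Sum>n = 1..N. g (int n)) + \<bar>real_of_int i\<bar>"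
proof -
  have step: "(\<Sum>n = 1..N. g (int n + (i + 1))) + g (i + 1) = (\<Sum>n = 1..N. g (int n + i)) + g (int N + i + 1)" for i
  proof (induction N)
    case (Suc N)
    have "int (Suc N) + (i + 1) = int (Suc N) + i + 1" by simp
    then show ?case using Suc by (simp add: ac_simps)
  qed simp
  show ?thesis
  proof (induction i rule: int_induct[of _ 0])
    case (step1 i)
    then show ?case using step[of i] g(1)[of "i + 1"] g(2)[of "int N + i + 1"] by simp
  next
    case (step2 i)
    then show ?case using step[of "i - 1"] g(2)[of i] g(1)[of "int N + i"] by simp
  qed simp
qed

text \<open>
  The discrepancy is itself a periodic function of \<open>N\<close>.
\<close>

lemma periodic_sum_bounded:
  fixes c :: "int \<Rightarrow> real"
  assumes c: "\<And>z. c (z + int L) = c z" and L: "L > 0"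
  shows "\<exists>C. \<forall>N. \<bar>(\<Sum>n = 1..N. c (int n)) - real N * ((\<Sum>v<L. c (int v)) / real L)\<bar> \<le> C"
proof -
  define S where "S N = (\<Sum>n = 1..N. c (int n)) - real N * ((\<Sum>v<L. c (int v)) / real L)" for N
  have per: "S (N + L) = S N" for N
  proof -
    have "(\<Sum>n = 1..N + L. c (int n)) = (\<Sum>n = 1..N. c (int n)) + (\<Sum>v<L. c (int v + (int N + 1)))"
    proof (induction L)
      case (Suc L)
      have "int L + (int N + 1) = 1 + (int N + int L)" by simp
      then show ?case using Suc by (simp add: ac_simps)
    qed simp
    also have "(\<Sum>v<L. c (int v + (int N + 1))) = (\<Sum>v<L. c (int v))"
      by (rule periodic_sum_shift) (rule c)
    finally show ?thesis using L by (simp add: S_def field_simps)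
  qed
  have per': "S (r + q * L) = S r" for r q
  proof (induction q)
    case (Suc q)
    then show ?case using per[of "r + q * L"] by (simp add: ac_simps)
  qed simp
  have "\<bar>S N\<bar> \<le> (\<Sum>r<L. \<bar>S r\<bar>)" for N
  proof -
    have "S N = S (N mod L)" using per'[of "N mod L" "N div L"] by simp
    also have "\<bar>S (N mod L)\<bar> \<le> (\<Sum>r<L. \<bar>S r\<bar>)"
      using L by (intro member_le_sum[of "N mod L" _ "\<lambda>r. \<bar>S r\<bar>"]) auto
    finally show ?thesis .
  qed
  then show ?thesis unfolding S_def by blast
qed

lemma periodic_average_tendsto:
  fixes c :: "int \<Rightarrow> real"
  assumes c: "\<And>z. c (z + int L) = c z" and L: "L > 0"
  shows "(\<lambda>N. (\<Sum>n = 1..N. c (int n)) / real N) \<longlonglongrightarrow> (\<Sum>v<L. c (int v)) / real L"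
proof -
  let ?A = "(\<Sum>v<L. c (int v)) / real L"
  obtain C where C: "\<And>N. \<bar>(\<Sum>n = 1..N. c (int n)) - real N * ?A\<bar> \<le> C"
    using periodic_sum_bounded[where c = c, OF c L] by blast
  have "(\<lambda>N. (\<Sum>n = 1..N. c (int n)) / real N - ?A) \<longlonglongrightarrow> 0"
  proof (rule Lim_null_comparison)
    show "\<forall>\<^sub>F N in sequentially. norm ((\<Sum>n = 1..N. c (int n)) / real N - ?A) \<le> C / real N"
      using eventually_gt_at_top[of 0]
    proof eventually_elim
      case (elim N)
      have "(\<Sum>n = 1..N. c (int n)) / real N - ?A = ((\<Sum>n = 1..N. c (int n)) - real N * ?A) / real N"
        using elim by (simp add: diff_divide_distrib)
      then show ?case using C[of N] elim by (simp add: abs_divide divide_right_mono)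
    qed
    show "(\<lambda>N. C / real N) \<longlonglongrightarrow> 0" by (rule lim_const_over_n)
  qed
  then show ?thesis by (simp add: LIM_zero_iff)
qed

section \<open>A uniformly distributed random profinite integer\<close>

text \<open>
  The integer with digits \<open>w\<close> in the factorial number system, truncated to the first \<open>k\<close> digits. With
  \<open>w j \<le> j\<close> these truncations lie below \<open>k!\<close> and are compatible modulo factorials, so they define a
  profinite integer.
\<close>

definition factoradic_prefix :: "(nat \<Rightarrow> nat) \<Rightarrow> nat \<Rightarrow> nat" where
  "factoradic_prefix w k = (\<Sum>j<k. w j * fact j)"

definition factoradic_digits :: "(nat \<Rightarrow> nat) measure" where
  "factoradic_digits = PiM UNIV (\<lambda>j. uniform_count_measure {0..j})"

lemma factoradic_prefix_less:
  assumes "\<And>j. w j \<le> j"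
  shows "factoradic_prefix w k < fact k"
proof (induction k)
  case (Suc k)
  have "w k * fact k \<le> k * fact k" using assms by (intro mult_right_mono) auto
  from add_less_le_mono[OF Suc this] show ?case by (simp add: factoradic_prefix_def)
qed (simp add: factoradic_prefix_def)

lemma fact_dvd_factoradic_prefix_diff:
  assumes "k \<le> l"
  shows "\<exists>q. factoradic_prefix w l = factoradic_prefix w k + fact k * q"
  using assms
proof (induction l rule: dec_induct)
  case base
  show ?case by (rule exI[of _ 0]) simp
next
  case (step l)
  then obtain q where "factoradic_prefix w l = factoradic_prefix w k + fact k * q" by blast
  moreover have "(fact k :: nat) dvd fact l" using step by (simp add: fact_dvd)
  then obtain r where "(fact l :: nat) = fact k * r" by (auto elim: dvdE)
  ultimately show ?case
    by (intro exI[of _ "q + r * w l"]) (simp add: factoradic_prefix_def algebra_simps)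
qed

lemma factoradic_prefix_mod:
  assumes "k \<le> l" "b dvd fact k"
  shows "int (factoradic_prefix w l) mod int b = int (factoradic_prefix w k) mod int b"
proof -
  obtain q where "factoradic_prefix w l = factoradic_prefix w k + fact k * q" using fact_dvd_factoradic_prefix_diff assms by blast
  moreover obtain c where "fact k = b * c" using assms by (auto elim: dvdE)
  ultimately have "factoradic_prefix w l = factoradic_prefix w k + b * (c * q)" by simp
  then show ?thesis by (metis mod_mult_self2 zmod_int)
qed

text \<open>
  Digits can be recovered from the number, which makes the digit expansion injective.
\<close>

lemma digit_eq:
  assumes w: "\<And>j. w j \<le> j" and j: "j < k"
  shows "w j = (factoradic_prefix w k div fact j) mod (Suc j)"
proof -
  obtain q where q: "factoradic_prefix w k = factoradic_prefix w (Suc j) + fact (Suc j) * q"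
    using fact_dvd_factoradic_prefix_diff[of "Suc j" k w] j by auto
  have "factoradic_prefix w k = factoradic_prefix w j + fact j * (w j + Suc j * q)"
    using q by (simp add: factoradic_prefix_def algebra_simps)
  then have "factoradic_prefix w k div fact j = w j + Suc j * q"
    using factoradic_prefix_less[OF w, of j] by simp
  then show ?thesis using w[of j] by (metis mod_mult_self2 mod_less le_imp_less_Suc)
qed

lemma prob_space_digit: "prob_space (uniform_count_measure {0..j::nat})"
  by (rule prob_space_uniform_count_measure) auto

lemma prob_space_factoradic_digits: "prob_space factoradic_digits"
  unfolding factoradic_digits_def by (rule prob_space_PiM) (rule prob_space_digit)

lemma space_factoradic_digits: "space factoradic_digits = {w. \<forall>j. w j \<le> j}"
  by (auto simp: factoradic_digits_def space_PiM space_uniform_count_measure)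

lemma measurable_digit: "(\<lambda>w. w j) \<in> measurable factoradic_digits (count_space UNIV)"
proof -
  have "(\<lambda>w. w j) \<in> measurable factoradic_digits (uniform_count_measure {0..j})"
    unfolding factoradic_digits_def by (rule measurable_component_singleton) simp
  from measurable_compose[OF this, of "\<lambda>x. x" "count_space UNIV"] show ?thesis
    by (simp add: measurable_def sets_uniform_count_measure space_uniform_count_measure)
qed

lemma measurable_factoradic_prefix: "(\<lambda>w. factoradic_prefix w k) \<in> measurable factoradic_digits (count_space UNIV)"
proof (induction k)
  case 0
  then show ?case by (simp add: factoradic_prefix_def)
next
  case (Suc k)
  have "(\<lambda>w. w k) \<in> measurable factoradic_digits (count_space UNIV)" by (rule measurable_digit)
  then have "(\<lambda>w. a + w k * fact k) \<in> measurable factoradic_digits (count_space UNIV)" for a :: nat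
    by (rule measurable_compose) simp
  from measurable_compose_countable[OF this Suc] show ?case by (simp add: factoradic_prefix_def)
qed

text \<open>
  By the recovery of digits, at most one vector of the first \<open>k\<close> digits yields \<open>v\<close>, and by independence
  it has probability \<open>1 / k!\<close>. So every \<open>v < k!\<close> has probability at most \<open>1 / k!\<close>; as these \<open>k!\<close>
  probabilities add up to 1, they all equal \<open>1 / k!\<close>.
\<close>

lemma measure_factoradic_prefix_eq:
  assumes v: "v < fact k"
  shows "measure factoradic_digits {w \<in> space factoradic_digits. factoradic_prefix w k = v} = 1 / fact k"
proof -
  interpret prob_space factoradic_digits by (rule prob_space_factoradic_digits)
  have le: "prob {w \<in> space factoradic_digits. factoradic_prefix w k = u} \<le> 1 / fact k" for u
  proof -
    define e where "e j = (u div fact j) mod (Suc j)" for j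
    have "{w \<in> space factoradic_digits. factoradic_prefix w k = u} \<subseteq> {w \<in> space factoradic_digits. \<forall>j\<in>{..<k}. w j \<in> {e j}}"
      using digit_eq by (auto simp: space_factoradic_digits e_def)
    moreover have ms: "{w \<in> space factoradic_digits. \<forall>j\<in>{..<k}. w j \<in> {e j}} \<in> sets factoradic_digits"
      by (intro sets.sets_Collect_finite_All measurable_sets_Collect[OF measurable_digit]) auto
    ultimately have "emeasure factoradic_digits {w \<in> space factoradic_digits. factoradic_prefix w k = u} \<le>
        emeasure factoradic_digits {w \<in> space factoradic_digits. \<forall>j\<in>{..<k}. w j \<in> {e j}}"
      by (rule emeasure_mono)
    also have "emeasure factoradic_digits {w \<in> space factoradic_digits. \<forall>j\<in>{..<k}. w j \<in> {e j}} =
       (\<Prod>j<k. emeasure (uniform_count_measure {0..j}) {e j})"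
    proof -
      interpret D: product_prob_space "\<lambda>j. uniform_count_measure {0..j::nat}" UNIV
        by (rule product_prob_spaceI) (rule prob_space_digit)
      show ?thesis unfolding factoradic_digits_def
        by (rule D.emeasure_PiM_Collect)
          (auto simp: sets_uniform_count_measure e_def le_less_Suc_eq intro!: Suc_leD mod_less_divisor order_trans[OF less_imp_le])
    qed
    also have "\<dots> = (\<Prod>j<k. ennreal (1 / Suc j))"
      by (intro prod.cong refl) (auto simp: emeasure_uniform_count_measure e_def less_Suc_eq_le[symmetric])
    also have "\<dots> = ennreal (\<Prod>j<k. 1 / Suc j)" by (rule prod_ennreal) simp
    also have "(\<Prod>j<k. 1 / real (Suc j)) = 1 / fact k"
      by (induction k) (simp_all add: mult.commute)
    finally show ?thesis by (simp add: emeasure_eq_measure)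
  qed
  have "(\<Sum>u<fact k. prob {w \<in> space factoradic_digits. factoradic_prefix w k = u}) = 1"
  proof -
    have "(\<Sum>u<fact k. prob {w \<in> space factoradic_digits. factoradic_prefix w k = u}) =
       prob (\<Union>u<fact k. {w \<in> space factoradic_digits. factoradic_prefix w k = u})"
      by (intro finite_measure_finite_Union[symmetric])
        (auto simp: disjoint_family_on_def intro!: measurable_sets_Collect[OF measurable_factoradic_prefix])
    also have "(\<Union>u<fact k. {w \<in> space factoradic_digits. factoradic_prefix w k = u}) = space factoradic_digits"
      using factoradic_prefix_less by (auto simp: space_factoradic_digits)
    finally show ?thesis by (simp add: prob_space)
  qed
  moreover have "(\<Sum>u<(fact k :: nat). 1 / fact k :: real) = 1"
    by simp
  ultimately have z: "(\<Sum>u<fact k. 1 / fact k - prob {w \<in> space factoradic_digits. factoradic_prefix w k = u}) = 0"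
    by (simp add: sum_subtractf)
  have "\<forall>u\<in>{..<fact k}. 1 / fact k - prob {w \<in> space factoradic_digits. factoradic_prefix w k = u} = 0"
    using le by (subst sum_nonneg_eq_0_iff[symmetric]) (auto simp: z[simplified])
  then show ?thesis using v by simp
qed

lemma distr_factoradic_prefix:
  "distr factoradic_digits (count_space UNIV) (\<lambda>w. factoradic_prefix w k) =
   distr (uniform_count_measure {..<fact k}) (count_space UNIV) (\<lambda>v. v)" (is "?L = ?R")
proof (rule measure_eqI_countable[where A = UNIV])
  interpret prob_space factoradic_digits by (rule prob_space_factoradic_digits)
  show "sets ?L = Pow UNIV" "sets ?R = Pow UNIV" by auto
  fix a :: nat
  have "emeasure ?L {a} = emeasure factoradic_digits {w \<in> space factoradic_digits. factoradic_prefix w k = a}"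
    by (subst emeasure_distr[OF measurable_factoradic_prefix]) (auto intro!: arg_cong2[where f = emeasure])
  also have "\<dots> = (if a < fact k then ennreal (1 / fact k) else 0)"
  proof (cases "a < fact k")
    case True
    then show ?thesis using measure_factoradic_prefix_eq[OF True] by (simp add: emeasure_eq_measure)
  next
    case False
    then have "{w \<in> space factoradic_digits. factoradic_prefix w k = a} = {}"
      using factoradic_prefix_less by (auto simp: space_factoradic_digits)
    then show ?thesis using False by (simp only: emeasure_empty if_False)
  qed
  also have "\<dots> = emeasure ?R {a}"
    by (subst emeasure_distr)
      (auto simp: space_uniform_count_measure emeasure_uniform_count_measure measurable_def sets_uniform_count_measure)
  finally show "emeasure ?L {a} = emeasure ?R {a}" .
qed auto

lemma integral_factoradic_prefix:
  fixes f :: "nat \<Rightarrow> real"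
  shows "integral\<^sup>L factoradic_digits (\<lambda>w. f (factoradic_prefix w k)) = (\<Sum>v<fact k. f v) / fact k"
proof -
  have "integral\<^sup>L factoradic_digits (\<lambda>w. f (factoradic_prefix w k)) =
      integral\<^sup>L (distr factoradic_digits (count_space UNIV) (\<lambda>w. factoradic_prefix w k)) f"
    by (rule integral_distr[OF measurable_factoradic_prefix, symmetric]) simp
  also have "\<dots> = integral\<^sup>L (uniform_count_measure {..<fact k}) f"
    unfolding distr_factoradic_prefix
    by (rule integral_distr) (auto simp: measurable_def sets_uniform_count_measure space_uniform_count_measure)
  finally show ?thesis by (simp add: integral_uniform_count_measure)
qed

section \<open>The Haar measure of the closure of the integers among the residues\<close>

definition residues_of :: "nat set \<Rightarrow> int \<Rightarrow> nat \<Rightarrow> int" where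
  "residues_of B n = (\<lambda>b\<in>B. n mod int b)"

definition residue_cyl :: "nat set \<Rightarrow> nat \<Rightarrow> int \<Rightarrow> (nat \<Rightarrow> int) set" where
  "residue_cyl B k n = {g \<in> G_set B. \<forall>b\<in>B. b \<le> k \<longrightarrow> g b = n mod int b}"

text \<open>
  The empty set makes the family closed under intersections.
\<close>

definition residue_cyls :: "nat set \<Rightarrow> (nat \<Rightarrow> int) set set" where
  "residue_cyls B = insert {} {residue_cyl B k n |k n. True}"

text \<open>
  The inverse in the group \<open>G_group B\<close>.
\<close>

definition neg_residues :: "nat set \<Rightarrow> (nat \<Rightarrow> int) \<Rightarrow> nat \<Rightarrow> int" where
  "neg_residues B x = (\<lambda>b\<in>B. (- x b) mod int b)"

context
  fixes B :: "nat set"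
  assumes B0: "0 \<notin> B"
begin

lemma B_pos: "b \<in> B \<Longrightarrow> 0 < b"
  using B0 by (metis gr0I)

lemma topspace_residue_topology: "topspace (residue_topology B) = (\<Pi>\<^sub>E b\<in>B. {0..<int b})"
proof -
  have "carrier (integer_mod_group b) = {0..<int b}" if "b \<in> B" for b
    using B_pos[OF that] by (simp add: carrier_integer_mod_group)
  then show ?thesis by (auto simp: residue_topology_def PiE_iff)
qed

text \<open>
  As \<open>B\<close> is a set of natural numbers, agreement on an initial segment of \<open>B\<close> is a neighbourhood base of
  the product topology. This gives the group the structure of a nested sequence of partitions, one
  for each level \<open>k\<close>.
\<close>

lemma openin_residue_topology:
  "openin (residue_topology B) S \<longleftrightarrow>
    S \<subseteq> topspace (residue_topology B) \<and>
    (\<forall>x\<in>S. \<exists>k. \<forall>y\<in>topspace (residue_topology B). (\<forall>b\<in>B. b \<le> k \<longrightarrow> y b = x b) \<longrightarrow> y \<in> S)"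
    (is "?L \<longleftrightarrow> ?R")
proof
  assume L: ?L
  show ?R
  proof (intro conjI ballI)
    show "S \<subseteq> topspace (residue_topology B)" using L by (rule openin_subset)
    fix x assume x: "x \<in> S"
    let ?c = "\<lambda>b. carrier (integer_mod_group b)"
    obtain U where U: "finite {b \<in> B. U b \<noteq> ?c b}" "x \<in> Pi\<^sub>E B U" "Pi\<^sub>E B U \<subseteq> S"
      using L x unfolding residue_topology_def openin_product_topology_alt topspace_discrete_topology
      by blast
    obtain k where k: "\<And>b. b \<in> B \<Longrightarrow> U b \<noteq> ?c b \<Longrightarrow> b \<le> k"
      using U(1) unfolding finite_nat_set_iff_bounded_le by blast
    show "\<exists>k. \<forall>y\<in>topspace (residue_topology B). (\<forall>b\<in>B. b \<le> k \<longrightarrow> y b = x b) \<longrightarrow> y \<in> S"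
    proof (intro exI[of _ k] ballI impI)
      fix y assume y: "y \<in> topspace (residue_topology B)" "\<forall>b\<in>B. b \<le> k \<longrightarrow> y b = x b"
      have "y b \<in> U b" if b: "b \<in> B" for b
      proof (cases "b \<le> k")
        case True
        then show ?thesis using y(2) b U(2) by auto
      next
        case False
        then have "U b = ?c b" using k b by blast
        then show ?thesis using y(1) b by (auto simp: residue_topology_def)
      qed
      then have "y \<in> Pi\<^sub>E B U" using y(1) by (auto simp: residue_topology_def PiE_iff)
      then show "y \<in> S" using U(3) by blast
    qed
  qed
next
  assume R: ?R
  show ?L unfolding residue_topology_def openin_product_topology_alt
  proof
    fix x assume x: "x \<in> S"
    obtain k where k: "\<And>y. y \<in> topspace (residue_topology B) \<Longrightarrow> (\<forall>b\<in>B. b \<le> k \<longrightarrow> y b = x b) \<Longrightarrow> y \<in> S"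
      using R x by blast
    define U where "U b = (if b \<le> k then {x b} else carrier (integer_mod_group b))" for b
    have xt: "x \<in> topspace (residue_topology B)" using R x by blast
    have "finite {b \<in> B. U b \<noteq> topspace (discrete_topology (carrier (integer_mod_group b)))}"
      by (rule finite_subset[of _ "{..k}"]) (auto simp: U_def)
    moreover have "openin (discrete_topology (carrier (integer_mod_group b))) (U b)" if "b \<in> B" for b
      using xt that by (auto simp: U_def residue_topology_def)
    moreover have "x \<in> Pi\<^sub>E B U" using xt by (auto simp: U_def residue_topology_def PiE_iff)
    moreover have "Pi\<^sub>E B U \<subseteq> S"
    proof
      fix y assume y: "y \<in> Pi\<^sub>E B U"
      have "y b \<in> carrier (integer_mod_group b)" if "b \<in> B" for b
        using PiE_mem[OF y that] xt that by (auto simp: U_def residue_topology_def PiE_iff split: if_splits)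
      then have "y \<in> topspace (residue_topology B)" using y by (auto simp: residue_topology_def PiE_iff)
      moreover have "\<forall>b\<in>B. b \<le> k \<longrightarrow> y b = x b" using y by (auto simp: U_def PiE_iff)
      ultimately show "y \<in> S" by (rule k)
    qed
    ultimately show "\<exists>U. finite {i \<in> B. U i \<noteq> topspace (discrete_topology (carrier (integer_mod_group i)))} \<and>
        (\<forall>i\<in>B. openin (discrete_topology (carrier (integer_mod_group i))) (U i)) \<and>
        x \<in> Pi\<^sub>E B U \<and> Pi\<^sub>E B U \<subseteq> S" by blast
  qed
qed

lemma G_set_iff:
  "g \<in> G_set B \<longleftrightarrow> g \<in> (\<Pi>\<^sub>E b\<in>B. {0..<int b}) \<and> (\<forall>k. \<exists>n. \<forall>b\<in>B. b \<le> k \<longrightarrow> g b = n mod int b)"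
proof
  assume g: "g \<in> G_set B"
  then have gt: "g \<in> topspace (residue_topology B)"
    unfolding G_set_def in_closure_of by blast
  have "\<exists>n. \<forall>b\<in>B. b \<le> k \<longrightarrow> g b = n mod int b" for k
  proof -
    let ?T = "{y \<in> topspace (residue_topology B). \<forall>b\<in>B. b \<le> k \<longrightarrow> y b = g b}"
    have "openin (residue_topology B) ?T" unfolding openin_residue_topology
      by (intro conjI ballI exI[of _ k]) auto
    moreover have "g \<in> ?T" using gt by simp
    moreover have "\<forall>T. g \<in> T \<and> openin (residue_topology B) T \<longrightarrow>
        (\<exists>y. y \<in> range (\<lambda>n. \<lambda>b\<in>B. n mod int b) \<and> y \<in> T)"
      using g unfolding G_set_def in_closure_of by (rule conjunct2)
    ultimately obtain n where n: "(\<lambda>b\<in>B. n mod int b) \<in> ?T" by (metis (no_types, lifting) rangeE)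
    have "g b = n mod int b" if "b \<in> B" "b \<le> k" for b
      using n that by simp
    then show ?thesis by blast
  qed
  then show "g \<in> (\<Pi>\<^sub>E b\<in>B. {0..<int b}) \<and> (\<forall>k. \<exists>n. \<forall>b\<in>B. b \<le> k \<longrightarrow> g b = n mod int b)"
    using gt by (simp add: topspace_residue_topology)
next
  assume R: "g \<in> (\<Pi>\<^sub>E b\<in>B. {0..<int b}) \<and> (\<forall>k. \<exists>n. \<forall>b\<in>B. b \<le> k \<longrightarrow> g b = n mod int b)"
  show "g \<in> G_set B" unfolding G_set_def in_closure_of
  proof (intro conjI allI impI)
    show "g \<in> topspace (residue_topology B)" using R by (simp add: topspace_residue_topology)
    fix T assume T: "g \<in> T \<and> openin (residue_topology B) T"
    then obtain k where k: "\<And>y. y \<in> topspace (residue_topology B) \<Longrightarrow> (\<forall>b\<in>B. b \<le> k \<longrightarrow> y b = g b) \<Longrightarrow> y \<in> T"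
      unfolding openin_residue_topology by blast
    obtain n where n: "\<forall>b\<in>B. b \<le> k \<longrightarrow> g b = n mod int b" using R by blast
    have "(\<lambda>b\<in>B. n mod int b) \<in> T"
      by (rule k) (use n B_pos in \<open>auto simp: topspace_residue_topology\<close>)
    then show "\<exists>y. y \<in> range (\<lambda>n. \<lambda>b\<in>B. n mod int b) \<and> y \<in> T" by blast
  qed
qed

lemma G_set_subset_topspace: "G_set B \<subseteq> topspace (residue_topology B)"
  using G_set_iff by (auto simp: topspace_residue_topology)

lemma residues_of_in_G_set: "residues_of B n \<in> G_set B"
  unfolding G_set_iff residues_of_def using B_pos by auto

lemma in_cyl_obtain:
  assumes "g \<in> G_set B"
  obtains n where "g \<in> residue_cyl B k n"
proof -
  obtain n where "\<forall>b\<in>B. b \<le> k \<longrightarrow> g b = n mod int b" using assms unfolding G_set_iff by blast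
  then show ?thesis using assms that[of n] by (simp add: residue_cyl_def)
qed

lemma openin_cyl: "openin (G_topology B) (residue_cyl B k n)"
proof -
  let ?T = "{y \<in> topspace (residue_topology B). \<forall>b\<in>B. b \<le> k \<longrightarrow> y b = n mod int b}"
  have "openin (residue_topology B) ?T" unfolding openin_residue_topology
    by (intro conjI ballI exI[of _ k]) auto
  moreover have "residue_cyl B k n = ?T \<inter> G_set B" using G_set_subset_topspace by (auto simp: residue_cyl_def)
  ultimately show ?thesis unfolding G_topology_def openin_subtopology by blast
qed

text \<open>
  There are only countably many cylinders, since their centres are integers, which are dense in the
  group. So the Borel sets are generated by cylinders.
\<close>

lemma openin_G_eq_Union_cyl:
  assumes "openin (G_topology B) U"
  shows "U = (\<Union>(k, n)\<in>{(k, n). residue_cyl B k n \<subseteq> U}. residue_cyl B k n)"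
proof (intro equalityI subsetI)
  fix x assume x: "x \<in> U"
  obtain T where T: "openin (residue_topology B) T" "U = T \<inter> G_set B"
    using assms unfolding G_topology_def openin_subtopology by blast
  obtain k where k: "\<And>y. y \<in> topspace (residue_topology B) \<Longrightarrow> (\<forall>b\<in>B. b \<le> k \<longrightarrow> y b = x b) \<Longrightarrow> y \<in> T"
    using T(1) x unfolding openin_residue_topology T(2) by blast
  obtain n where n: "x \<in> residue_cyl B k n" using in_cyl_obtain x T(2) by blast
  have "residue_cyl B k n \<subseteq> U"
  proof
    fix y assume y: "y \<in> residue_cyl B k n"
    then have "y \<in> T" using G_set_subset_topspace n by (intro k) (auto simp: residue_cyl_def)
    then show "y \<in> U" using y T(2) by (auto simp: residue_cyl_def)
  qed
  then show "x \<in> (\<Union>(k, n)\<in>{(k, n). residue_cyl B k n \<subseteq> U}. residue_cyl B k n)" using n by blast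
qed auto

lemma cyls_subset_Pow: "residue_cyls B \<subseteq> Pow (G_set B)"
  by (auto simp: residue_cyls_def residue_cyl_def)

lemma sigma_sets_openin_G: "sigma_sets (G_set B) {U. openin (G_topology B) U} = sigma_sets (G_set B) (residue_cyls B)"
proof (rule sigma_sets_eqI)
  fix U assume "U \<in> {U. openin (G_topology B) U}"
  then have U: "U = (\<Union>(k, n)\<in>{(k, n). residue_cyl B k n \<subseteq> U}. residue_cyl B k n)"
    by (simp add: openin_G_eq_Union_cyl[symmetric])
  interpret sigma_algebra "G_set B" "sigma_sets (G_set B) (residue_cyls B)"
    by (rule sigma_algebra_sigma_sets[OF cyls_subset_Pow])
  show "U \<in> sigma_sets (G_set B) (residue_cyls B)"
    by (subst U, rule countable_UN') (auto simp: residue_cyls_def intro!: sigma_sets.Basic)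
next
  fix C assume "C \<in> residue_cyls B"
  then have "openin (G_topology B) C" by (auto simp: residue_cyls_def openin_cyl)
  then show "C \<in> sigma_sets (G_set B) {U. openin (G_topology B) U}" by (intro sigma_sets.Basic) simp
qed

lemma cyl_cong:
  assumes "\<And>b. b \<in> B \<Longrightarrow> b \<le> k \<Longrightarrow> n mod int b = m mod int b"
  shows "residue_cyl B k n = residue_cyl B k m"
  using assms by (auto simp: residue_cyl_def)

lemma cyl_disjoint:
  assumes "g \<in> residue_cyl B k n" "g \<in> residue_cyl B k m"
  shows "residue_cyl B k n = residue_cyl B k m"
  using assms by (intro cyl_cong) (auto simp: residue_cyl_def)

lemma cyl_mono: "k \<le> l \<Longrightarrow> residue_cyl B l n \<subseteq> residue_cyl B k n"
  by (auto simp: residue_cyl_def)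

lemma cyl_Int_in_cyls: "residue_cyl B k n \<inter> residue_cyl B l m \<in> residue_cyls B" if "k \<le> l" for k l n m
proof (cases "residue_cyl B k n \<inter> residue_cyl B l m = {}")
  case False
  then obtain g where g: "g \<in> residue_cyl B k n" "g \<in> residue_cyl B l m" by blast
  then have "g \<in> residue_cyl B k m" using cyl_mono[OF that] by blast
  then have "residue_cyl B k n = residue_cyl B k m" by (rule cyl_disjoint[OF g(1)])
  then have "residue_cyl B k n \<inter> residue_cyl B l m = residue_cyl B l m" using cyl_mono[OF that] by blast
  then show ?thesis by (auto simp: residue_cyls_def)
qed (simp add: residue_cyls_def)

text \<open>
  Two cylinders of the same level are equal or disjoint, and a cylinder of a higher level lies in a
  single cylinder of each lower level.
\<close>

lemma Int_stable_cyls: "Int_stable (residue_cyls B)"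
proof (rule Int_stableI)
  fix C D assume "C \<in> residue_cyls B" "D \<in> residue_cyls B"
  then consider "C \<inter> D = {}" | k n l m where "C = residue_cyl B k n" "D = residue_cyl B l m"
    by (auto simp: residue_cyls_def)
  then show "C \<inter> D \<in> residue_cyls B"
  proof cases
    case (2 k n l m)
    then show ?thesis using cyl_Int_in_cyls[of k l n m] cyl_Int_in_cyls[of l k m n]
      by (cases k l rule: le_cases) (auto simp: Int_commute)
  qed (simp add: residue_cyls_def)
qed

text \<open>
  The whole group is a cylinder because 0 is not an element of \<open>B\<close>.
\<close>

lemma cyl_0: "residue_cyl B 0 n = G_set B"
  using B_pos by (auto simp: residue_cyl_def)

lemma measure_eqI_cyl:
  assumes "sets P = sigma_sets (G_set B) (residue_cyls B)" "sets Q = sigma_sets (G_set B) (residue_cyls B)"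
    and "\<And>k n. emeasure P (residue_cyl B k n) = emeasure Q (residue_cyl B k n)"
    and "emeasure P (G_set B) \<noteq> \<infinity>"
  shows "P = Q"
proof (rule measure_eqI_generator_eq[OF Int_stable_cyls cyls_subset_Pow _ assms(1,2), where A = "\<lambda>_. G_set B"])
  show "emeasure P X = emeasure Q X" if "X \<in> residue_cyls B" for X
    using that assms(3) by (auto simp: residue_cyls_def)
  show "range (\<lambda>_::nat. G_set B) \<subseteq> residue_cyls B" unfolding residue_cyls_def cyl_0[of 0, symmetric] by blast
qed (use assms in auto)

lemma range_cyl_finite: "finite (range (residue_cyl B k))"
proof -
  have "residue_cyl B k n = residue_cyl B k (n mod fact k)" for n
  proof (rule cyl_cong)
    fix b assume "b \<in> B" "b \<le> k"
    then have "b dvd fact k" using B_pos by (intro dvd_fact) (auto simp: Suc_le_eq)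
    then have "int b dvd fact k" by (metis of_nat_dvd_iff of_nat_fact)
    then show "n mod int b = n mod fact k mod int b" by (simp add: mod_mod_cancel)
  qed
  moreover have "n mod fact k \<in> {0..<fact k}" for n :: int by simp
  ultimately have "range (residue_cyl B k) \<subseteq> residue_cyl B k ` {0..<fact k}" by blast
  then show ?thesis by (rule finite_subset) simp
qed

lemma cyl_in_sets:
  assumes "sets P = sigma_sets (G_set B) (residue_cyls B)"
  shows "residue_cyl B k n \<in> sets P"
  unfolding assms by (rule sigma_sets.Basic) (auto simp: residue_cyls_def)

text \<open>
  Equal mass on the cylinders of level \<open>k\<close> fixes this mass, because the finitely many distinct ones
  partition the group. This is the source of all uniqueness statements below.
\<close>

lemma emeasure_cyl:
  assumes P: "sets P = sigma_sets (G_set B) (residue_cyls B)"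
    and eq: "\<And>n. emeasure P (residue_cyl B k n) = emeasure P (residue_cyl B k 0)"
  shows "emeasure P (residue_cyl B k n) = emeasure P (G_set B) / of_nat (card (range (residue_cyl B k)))"
proof -
  have "G_set B = \<Union>(range (residue_cyl B k))"
    by (auto elim: in_cyl_obtain[where k = k]) (simp add: residue_cyl_def)
  then have "emeasure P (G_set B) = emeasure P (\<Union>C\<in>range (residue_cyl B k). C)" by simp
  also have "\<dots> = (\<Sum>C\<in>range (residue_cyl B k). emeasure P C)"
  proof (rule sum_emeasure[symmetric])
    show "(\<lambda>C. C) ` range (residue_cyl B k) \<subseteq> sets P" using cyl_in_sets[OF P] by auto
    show "disjoint_family_on (\<lambda>C. C) (range (residue_cyl B k))"
      using cyl_disjoint unfolding disjoint_family_on_def by blast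
  qed (rule range_cyl_finite)
  also have "\<dots> = (\<Sum>C\<in>range (residue_cyl B k). emeasure P (residue_cyl B k n))"
    by (intro sum.cong refl) (metis eq rangeE)
  also have "\<dots> = of_nat (card (range (residue_cyl B k))) * emeasure P (residue_cyl B k n)" by simp
  finally have e: "emeasure P (G_set B) = of_nat (card (range (residue_cyl B k))) * emeasure P (residue_cyl B k n)" .
  have "card (range (residue_cyl B k)) \<noteq> 0" using range_cyl_finite by auto
  then show ?thesis unfolding e
    by (simp add: ennreal_mult_divide_eq mult.commute ennreal_of_nat_eq_real_of_nat)
qed

lemma mult_G_group: "x \<otimes>\<^bsub>G_group B\<^esub> y = (\<lambda>b\<in>B. (x b + y b) mod int b)"
  by (simp add: G_group_def product_group_def)

lemma carrier_G_group: "carrier (G_group B) = G_set B"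
  by (simp add: G_group_def)

lemma mult_closed:
  assumes "x \<in> G_set B" "y \<in> G_set B"
  shows "x \<otimes>\<^bsub>G_group B\<^esub> y \<in> G_set B"
  unfolding G_set_iff mult_G_group
proof (intro conjI allI)
  show "(\<lambda>b\<in>B. (x b + y b) mod int b) \<in> (\<Pi>\<^sub>E b\<in>B. {0..<int b})" using B_pos by auto
  fix k
  obtain n m where "x \<in> residue_cyl B k n" "y \<in> residue_cyl B k m" using in_cyl_obtain assms by metis
  then show "\<exists>n. \<forall>b\<in>B. b \<le> k \<longrightarrow> (\<lambda>b\<in>B. (x b + y b) mod int b) b = n mod int b"
    by (intro exI[of _ "n + m"]) (auto simp: residue_cyl_def mod_add_eq)
qed

lemma neg_closed:
  assumes "x \<in> G_set B"
  shows "neg_residues B x \<in> G_set B"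
  unfolding G_set_iff
proof (intro conjI allI)
  show "neg_residues B x \<in> (\<Pi>\<^sub>E b\<in>B. {0..<int b})"
    unfolding neg_residues_def PiE_iff extensional_def using B_pos by simp
  fix k
  obtain n where n: "x \<in> residue_cyl B k n" using in_cyl_obtain assms by metis
  have "neg_residues B x b = (- n) mod int b" if "b \<in> B" "b \<le> k" for b
  proof -
    have "x b = n mod int b" using n that unfolding residue_cyl_def by blast
    then show ?thesis using that(1) unfolding neg_residues_def by (simp only: restrict_apply' mod_minus_eq)
  qed
  then show "\<exists>n. \<forall>b\<in>B. b \<le> k \<longrightarrow> neg_residues B x b = n mod int b" by blast
qed

lemma G_set_mod:
  assumes "y \<in> G_set B" "b \<in> B"
  shows "y b mod int b = y b"
proof -
  have "y b \<in> {0..<int b}" using assms unfolding G_set_iff PiE_iff by blast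
  then show ?thesis by simp
qed

lemma G_set_restrict: "y \<in> G_set B \<Longrightarrow> restrict y B = y"
  unfolding G_set_iff PiE_iff by (blast intro: extensional_restrict)

lemma neg_mult_cancel:
  assumes "y \<in> G_set B"
  shows "neg_residues B x \<otimes>\<^bsub>G_group B\<^esub> (x \<otimes>\<^bsub>G_group B\<^esub> y) = y"
    and "x \<otimes>\<^bsub>G_group B\<^esub> (neg_residues B x \<otimes>\<^bsub>G_group B\<^esub> y) = y"
proof -
  have e: "((- a) mod c + (a + d) mod c) mod c = d mod c" "(a + ((- a) mod c + d) mod c) mod c = d mod c"
    for a c d :: int by (simp_all add: mod_simps)
  have "neg_residues B x \<otimes>\<^bsub>G_group B\<^esub> (x \<otimes>\<^bsub>G_group B\<^esub> y) = restrict y B"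
    "x \<otimes>\<^bsub>G_group B\<^esub> (neg_residues B x \<otimes>\<^bsub>G_group B\<^esub> y) = restrict y B"
    unfolding mult_G_group neg_residues_def
    by (intro restrict_ext, simp only: restrict_apply' e G_set_mod[OF assms])+
  then show "neg_residues B x \<otimes>\<^bsub>G_group B\<^esub> (x \<otimes>\<^bsub>G_group B\<^esub> y) = y"
    "x \<otimes>\<^bsub>G_group B\<^esub> (neg_residues B x \<otimes>\<^bsub>G_group B\<^esub> y) = y"
    using G_set_restrict[OF assms] by simp_all
qed

lemma mult_image_eq:
  assumes x: "x \<in> G_set B" and A: "A \<subseteq> G_set B"
  shows "(\<lambda>y. x \<otimes>\<^bsub>G_group B\<^esub> y) ` A = (\<lambda>y. neg_residues B x \<otimes>\<^bsub>G_group B\<^esub> y) -` A \<inter> G_set B"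
proof (intro equalityI subsetI)
  fix z assume "z \<in> (\<lambda>y. x \<otimes>\<^bsub>G_group B\<^esub> y) ` A"
  then obtain y where "y \<in> A" "z = x \<otimes>\<^bsub>G_group B\<^esub> y" by blast
  then show "z \<in> (\<lambda>y. neg_residues B x \<otimes>\<^bsub>G_group B\<^esub> y) -` A \<inter> G_set B"
    using A neg_mult_cancel(1)[of y x] mult_closed[OF x, of y] by auto
next
  fix z assume "z \<in> (\<lambda>y. neg_residues B x \<otimes>\<^bsub>G_group B\<^esub> y) -` A \<inter> G_set B"
  then show "z \<in> (\<lambda>y. x \<otimes>\<^bsub>G_group B\<^esub> y) ` A"
    using neg_mult_cancel(2)[of z x] by (auto intro!: image_eqI[of _ _ "neg_residues B x \<otimes>\<^bsub>G_group B\<^esub> z"])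
qed

lemma vimage_mult_cyl:
  assumes x: "x \<in> residue_cyl B k m"
  shows "(\<lambda>y. x \<otimes>\<^bsub>G_group B\<^esub> y) -` residue_cyl B k n \<inter> G_set B = residue_cyl B k (n - m)"
proof -
  have xG: "x \<in> G_set B" using x by (simp add: residue_cyl_def)
  have "(x b + y b) mod int b = n mod int b \<longleftrightarrow> y b = (n - m) mod int b"
    if y: "y \<in> G_set B" and b: "b \<in> B" "b \<le> k" for y b
  proof -
    have xb: "x b mod int b = m mod int b" using x b by (auto simp: residue_cyl_def)
    have "(x b + y b) mod int b = n mod int b \<longleftrightarrow> (m + y b) mod int b = n mod int b"
      using xb by (metis mod_add_left_eq)
    also have "\<dots> \<longleftrightarrow> y b mod int b = (n - m) mod int b"
      by (simp add: mod_eq_dvd_iff algebra_simps)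
    finally show ?thesis using G_set_mod[OF y b(1)] by simp
  qed
  then show ?thesis using mult_closed[OF xG] by (auto simp: residue_cyl_def mult_G_group)
qed

lemma measurable_mult:
  assumes P: "space P = G_set B" "sets P = sigma_sets (G_set B) (residue_cyls B)" and x: "x \<in> G_set B"
  shows "(\<lambda>y. x \<otimes>\<^bsub>G_group B\<^esub> y) \<in> measurable P P"
proof (rule measurable_sigma_sets[OF P(2) cyls_subset_Pow])
  show "(\<lambda>y. x \<otimes>\<^bsub>G_group B\<^esub> y) \<in> space P \<rightarrow> G_set B" using mult_closed[OF x] P by auto
  fix C assume "C \<in> residue_cyls B"
  then consider "C = {}" | k n where "C = residue_cyl B k n" by (auto simp: residue_cyls_def)
  then show "(\<lambda>y. x \<otimes>\<^bsub>G_group B\<^esub> y) -` C \<inter> space P \<in> sets P"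
  proof cases
    case (2 k n)
    obtain m where "x \<in> residue_cyl B k m" using in_cyl_obtain x by metis
    then show ?thesis using 2 vimage_mult_cyl cyl_in_sets[OF P(2)] P(1) by simp
  qed simp
qed

text \<open>
  The residue modulo \<open>b\<close> is determined by the first \<open>b\<close> digits, because \<open>b\<close> divides \<open>b!\<close>.
\<close>

definition profinite_residues :: "(nat \<Rightarrow> nat) \<Rightarrow> nat \<Rightarrow> int" where
  "profinite_residues w = (\<lambda>b\<in>B. int (factoradic_prefix w b) mod int b)"

definition digit_haar :: "(nat \<Rightarrow> int) measure" where
  "digit_haar = distr factoradic_digits (sigma (G_set B) (residue_cyls B)) profinite_residues"

lemma factoradic_prefix_mod_B:
  assumes "b \<in> B" "b \<le> k"
  shows "int (factoradic_prefix w k) mod int b = int (factoradic_prefix w b) mod int b"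
  using assms B_pos[of b] by (intro factoradic_prefix_mod dvd_fact) auto

lemma profinite_residues_eq_mod:
  assumes "b \<in> B" "b \<le> k"
  shows "profinite_residues w b = int (factoradic_prefix w k) mod int b"
  unfolding profinite_residues_def restrict_apply' [OF assms(1)] by (rule factoradic_prefix_mod_B[OF assms, symmetric])

lemma profinite_residues_in_G: "profinite_residues w \<in> G_set B"
  unfolding G_set_iff
proof (intro conjI allI)
  show "profinite_residues w \<in> (\<Pi>\<^sub>E b\<in>B. {0..<int b})"
    using B_pos by (auto simp: profinite_residues_def)
  fix k
  show "\<exists>n. \<forall>b\<in>B. b \<le> k \<longrightarrow> profinite_residues w b = n mod int b"
    by (intro exI[of _ "int (factoradic_prefix w k)"] ballI impI profinite_residues_eq_mod)
qed

lemma profinite_residues_in_cyl: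
  "profinite_residues w \<in> residue_cyl B k n \<longleftrightarrow> (\<forall>b\<in>B. b \<le> k \<longrightarrow> int (factoradic_prefix w k) mod int b = n mod int b)"
  using profinite_residues_in_G by (auto simp: residue_cyl_def profinite_residues_eq_mod[where k = k])

lemma measurable_profinite_residues:
  "profinite_residues \<in> measurable factoradic_digits (sigma (G_set B) (residue_cyls B))"
proof (rule measurable_measure_of[OF cyls_subset_Pow])
  show "profinite_residues \<in> space factoradic_digits \<rightarrow> G_set B" using profinite_residues_in_G by auto
  fix C assume "C \<in> residue_cyls B"
  then consider "C = {}" | k n where "C = residue_cyl B k n" by (auto simp: residue_cyls_def)
  then show "profinite_residues -` C \<inter> space factoradic_digits \<in> sets factoradic_digits"
  proof cases
    case (2 k n)
    have "profinite_residues -` C \<inter> space factoradic_digits =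
        (\<lambda>w. factoradic_prefix w k) -` {v. \<forall>b\<in>B. b \<le> k \<longrightarrow> int v mod int b = n mod int b} \<inter> space factoradic_digits"
      unfolding 2 by (auto simp: profinite_residues_in_cyl)
    also have "\<dots> \<in> sets factoradic_digits" by (rule measurable_sets[OF measurable_factoradic_prefix]) simp
    finally show ?thesis .
  qed simp
qed

lemma cyl_in_sigma: "residue_cyl B k n \<in> sets (sigma (G_set B) (residue_cyls B))"
  by (rule cyl_in_sets) (simp add: cyls_subset_Pow)

lemma sets_digit_haar: "sets digit_haar = sigma_sets (G_set B) (residue_cyls B)"
  by (simp add: digit_haar_def cyls_subset_Pow)

lemma space_digit_haar: "space digit_haar = G_set B"
  by (simp add: digit_haar_def space_measure_of[OF cyls_subset_Pow])

lemma prob_space_digit_haar: "prob_space digit_haar"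
  unfolding digit_haar_def using prob_space_factoradic_digits measurable_profinite_residues
  by (rule prob_space.prob_space_distr)

text \<open>
  Membership in a cylinder of level \<open>k\<close> is a condition of period \<open>k!\<close> on the integer given by the first \<open>k\<close>
  digits, which is uniform below \<open>k!\<close>; replacing the centre \<open>n\<close> by 0 shifts this condition.
\<close>

lemma emeasure_digit_haar_cyl: "emeasure digit_haar (residue_cyl B k n) = emeasure digit_haar (residue_cyl B k 0)"
proof -
  interpret D: prob_space factoradic_digits by (rule prob_space_factoradic_digits)
  define p :: "int \<Rightarrow> real" where "p z = of_bool (\<forall>b\<in>B. b \<le> k \<longrightarrow> int b dvd z)" for z
  have per: "p (z + int (fact k)) = p z" for z
  proof -
    have "int b dvd int (fact k)" if "b \<in> B" "b \<le> k" for b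
      using B_pos[of b] that by (metis Suc_leI dvd_fact of_nat_dvd_iff One_nat_def)
    then have "\<forall>b\<in>B. b \<le> k \<longrightarrow> (int b dvd z + int (fact k) \<longleftrightarrow> int b dvd z)"
      by (intro ballI impI dvd_add_left_iff)
    then have "(\<forall>b\<in>B. b \<le> k \<longrightarrow> int b dvd z + int (fact k)) \<longleftrightarrow> (\<forall>b\<in>B. b \<le> k \<longrightarrow> int b dvd z)"
      by blast
    then show ?thesis unfolding p_def by (rule arg_cong)
  qed
  have "emeasure digit_haar (residue_cyl B k n) = ennreal ((\<Sum>v<fact k. p (int v)) / fact k)" for n
  proof -
    have "emeasure digit_haar (residue_cyl B k n) = emeasure factoradic_digits (profinite_residues -` residue_cyl B k n \<inter> space factoradic_digits)"
      unfolding digit_haar_def by (rule emeasure_distr[OF measurable_profinite_residues])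
        (rule cyl_in_sigma)
    also have "\<dots> = ennreal (integral\<^sup>L factoradic_digits (indicator (profinite_residues -` residue_cyl B k n \<inter> space factoradic_digits)))"
    proof -
      have "profinite_residues -` residue_cyl B k n \<inter> space factoradic_digits \<in> sets factoradic_digits"
        by (rule measurable_sets[OF measurable_profinite_residues cyl_in_sigma])
      then show ?thesis by (simp add: D.emeasure_eq_measure)
    qed
    also have "integral\<^sup>L factoradic_digits (indicator (profinite_residues -` residue_cyl B k n \<inter> space factoradic_digits)) =
        integral\<^sup>L factoradic_digits (\<lambda>w. p (int (factoradic_prefix w k) - n))"
      by (intro Bochner_Integration.integral_cong refl)
        (auto simp: p_def indicator_def profinite_residues_in_cyl mod_eq_dvd_iff)
    also have "\<dots> = (\<Sum>v<fact k. p (int v - n)) / fact k"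
      by (rule integral_factoradic_prefix)
    also have "(\<Sum>v<fact k. p (int v - n)) = (\<Sum>v<fact k. p (int v))"
      using periodic_sum_shift[of p "fact k" "- n", OF per] by simp
    finally show ?thesis .
  qed
  then show ?thesis by simp
qed

text \<open>
  Translations permute the cylinders of each level, and these have equal mass.
\<close>

lemma digit_haar_distr_mult:
  assumes x: "x \<in> G_set B"
  shows "distr digit_haar digit_haar (\<lambda>y. x \<otimes>\<^bsub>G_group B\<^esub> y) = digit_haar" (is "?D = _")
proof (rule measure_eqI_cyl)
  interpret prob_space digit_haar by (rule prob_space_digit_haar)
  note ms = measurable_mult[OF space_digit_haar sets_digit_haar x]
  show "sets ?D = sigma_sets (G_set B) (residue_cyls B)" by (simp add: sets_digit_haar)
  show "sets digit_haar = sigma_sets (G_set B) (residue_cyls B)" by (rule sets_digit_haar)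
  show "emeasure ?D (G_set B) \<noteq> \<infinity>"
    using prob_space.emeasure_space_1[OF prob_space_distr[OF ms]] by (simp add: space_digit_haar)
  fix k n
  obtain m where m: "x \<in> residue_cyl B k m" using in_cyl_obtain x by metis
  have "emeasure ?D (residue_cyl B k n) = emeasure digit_haar (residue_cyl B k (n - m))"
    by (simp add: emeasure_distr[OF ms] cyl_in_sets[OF sets_digit_haar] space_digit_haar vimage_mult_cyl[OF m])
  then show "emeasure ?D (residue_cyl B k n) = emeasure digit_haar (residue_cyl B k n)"
    using emeasure_digit_haar_cyl by metis
qed

lemma is_normalized_haar_digit_haar: "is_normalized_haar (G_group B) (G_topology B) digit_haar"
  unfolding is_normalized_haar_def carrier_G_group
proof (intro conjI ballI)
  show "prob_space digit_haar" by (rule prob_space_digit_haar)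
  show "space digit_haar = G_set B" by (rule space_digit_haar)
  show "sets digit_haar = sigma_sets (G_set B) {U. openin (G_topology B) U}"
    by (simp add: sets_digit_haar sigma_sets_openin_G)
  fix x A assume x: "x \<in> G_set B" and A: "A \<in> sets digit_haar"
  have nx: "neg_residues B x \<in> G_set B" by (rule neg_closed[OF x])
  have "A \<subseteq> G_set B" using sets.sets_into_space[OF A] by (simp add: space_digit_haar)
  then have "emeasure digit_haar ((\<lambda>y. x \<otimes>\<^bsub>G_group B\<^esub> y) ` A) =
      emeasure (distr digit_haar digit_haar (\<lambda>y. neg_residues B x \<otimes>\<^bsub>G_group B\<^esub> y)) A"
    using A by (simp add: mult_image_eq[OF x] space_digit_haar
        emeasure_distr[OF measurable_mult[OF space_digit_haar sets_digit_haar nx]])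
  then show "emeasure digit_haar ((\<lambda>y. x \<otimes>\<^bsub>G_group B\<^esub> y) ` A) = emeasure digit_haar A"
    by (simp add: digit_haar_distr_mult[OF nx])
qed

lemma residues_of_in_cyl: "residues_of B n \<in> residue_cyl B k n"
  using residues_of_in_G_set by (auto simp: residue_cyl_def residues_of_def)

text \<open>
  Translation by the image of \<open>n\<close> carries the cylinder around 0 to the cylinder around \<open>n\<close>, so an
  invariant measure has equal mass on the cylinders of each level.
\<close>

lemma normalized_haar_unique:
  assumes "is_normalized_haar (G_group B) (G_topology B) P"
  shows "P = digit_haar"
proof (rule measure_eqI_cyl)
  have P: "prob_space P" "space P = G_set B" "sets P = sigma_sets (G_set B) (residue_cyls B)"
    and inv: "\<And>x A. x \<in> G_set B \<Longrightarrow> A \<in> sets P \<Longrightarrow> emeasure P ((\<lambda>y. x \<otimes>\<^bsub>G_group B\<^esub> y) ` A) = emeasure P A"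
    using assms by (auto simp: is_normalized_haar_def carrier_G_group sigma_sets_openin_G)
  show "sets P = sigma_sets (G_set B) (residue_cyls B)" by fact
  show "sets digit_haar = sigma_sets (G_set B) (residue_cyls B)" by (rule sets_digit_haar)
  have P1: "emeasure P (G_set B) = 1" using prob_space.emeasure_space_1[OF P(1)] P(2) by simp
  then show "emeasure P (G_set B) \<noteq> \<infinity>" by simp
  have Q1: "emeasure digit_haar (G_set B) = 1"
    using prob_space.emeasure_space_1[OF prob_space_digit_haar] space_digit_haar by simp
  fix k n
  have "emeasure P (residue_cyl B k n) = emeasure P (residue_cyl B k 0)" for n
  proof -
    have "neg_residues B (residues_of B n) \<in> residue_cyl B k (- n)"
      using neg_closed[OF residues_of_in_G_set]
      by (auto simp: residue_cyl_def neg_residues_def residues_of_def mod_minus_eq)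
    then have "(\<lambda>y. residues_of B n \<otimes>\<^bsub>G_group B\<^esub> y) ` residue_cyl B k 0 = residue_cyl B k n"
      using vimage_mult_cyl[of "neg_residues B (residues_of B n)" k "- n" 0]
      by (subst mult_image_eq[OF residues_of_in_G_set]) (auto simp: residue_cyl_def)
    then show ?thesis using inv[OF residues_of_in_G_set cyl_in_sets[OF P(3)], of n k 0] by simp
  qed
  from emeasure_cyl[OF P(3) this, of n] emeasure_cyl[OF sets_digit_haar emeasure_digit_haar_cyl, of k n]
  show "emeasure P (residue_cyl B k n) = emeasure digit_haar (residue_cyl B k n)"
    by (simp only: P1 Q1)
qed

lemma haar_measure_eq: "haar_measure B = digit_haar"
  unfolding haar_measure_def
  by (rule the_equality) (rule is_normalized_haar_digit_haar, rule normalized_haar_unique)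

text \<open>
  The restriction \<open>Q\<close> of the Haar measure \<open>\<mu>\<close> to \<open>A\<close> is again invariant under translation by the image of
  1, hence \<open>Q = \<mu>(A) \<cdot> \<mu>\<close>. Evaluating at \<open>A\<close> gives \<open>\<mu>(A) = \<mu>(A)\<^sup>2\<close>.
\<close>

lemma digit_haar_ergodic:
  assumes A: "A \<in> sets digit_haar"
    and inv: "\<And>g. g \<in> G_set B \<Longrightarrow> residues_of B 1 \<otimes>\<^bsub>G_group B\<^esub> g \<in> A \<longleftrightarrow> g \<in> A"
  shows "measure digit_haar A = 0 \<or> measure digit_haar A = 1"
proof -
  interpret prob_space digit_haar by (rule prob_space_digit_haar)
  define Q where "Q = density digit_haar (indicator A)"
  define t where "t = (\<lambda>g. residues_of B 1 \<otimes>\<^bsub>G_group B\<^esub> g)"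
  have tm: "t \<in> measurable digit_haar digit_haar"
    unfolding t_def by (rule measurable_mult[OF space_digit_haar sets_digit_haar residues_of_in_G_set])
  have AG: "A \<subseteq> G_set B" using sets.sets_into_space[OF A] by (simp add: space_digit_haar)
  have Q: "emeasure Q C = emeasure digit_haar (A \<inter> C)" if "C \<in> sets digit_haar" for C
    unfolding Q_def using A that by (rule emeasure_restricted)
  have setsQ: "sets Q = sigma_sets (G_set B) (residue_cyls B)" by (simp add: Q_def sets_digit_haar)
  have step: "emeasure Q (residue_cyl B k (n + 1)) = emeasure Q (residue_cyl B k n)" for k n
  proof -
    have "emeasure Q (residue_cyl B k (n + 1)) = emeasure (distr digit_haar digit_haar t) (A \<inter> residue_cyl B k (n + 1))"
      by (simp add: Q cyl_in_sets[OF sets_digit_haar] t_def digit_haar_distr_mult[OF residues_of_in_G_set])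
    also have "\<dots> = emeasure digit_haar (t -` (A \<inter> residue_cyl B k (n + 1)) \<inter> G_set B)"
      using A cyl_in_sets[OF sets_digit_haar] by (subst emeasure_distr[OF tm]) (auto simp: space_digit_haar)
    also have "t -` (A \<inter> residue_cyl B k (n + 1)) \<inter> G_set B = A \<inter> (t -` residue_cyl B k (n + 1) \<inter> G_set B)"
      using inv AG by (auto simp: t_def)
    also have "t -` residue_cyl B k (n + 1) \<inter> G_set B = residue_cyl B k n"
      unfolding t_def using vimage_mult_cyl[OF residues_of_in_cyl, of 1 k "n + 1"] by simp
    finally show ?thesis by (simp add: Q cyl_in_sets[OF sets_digit_haar])
  qed
  have const: "emeasure Q (residue_cyl B k n) = emeasure Q (residue_cyl B k 0)" for k n
  proof (induction n rule: int_induct[of _ 0])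
    case (step2 i)
    then show ?case using step[of k "i - 1"] by simp
  qed (simp_all add: step)
  have G1: "emeasure digit_haar (G_set B) = 1" using emeasure_space_1 by (simp add: space_digit_haar)
  have "Q = scale_measure (emeasure Q (G_set B)) digit_haar"
  proof (rule measure_eqI_cyl[OF setsQ])
    show "sets (scale_measure (emeasure Q (G_set B)) digit_haar) = sigma_sets (G_set B) (residue_cyls B)"
      by (simp add: sets_digit_haar)
    have "emeasure Q (G_set B) = emeasure digit_haar A"
      using Q[of "G_set B"] AG sets.top[of digit_haar] by (simp add: space_digit_haar Int_absorb2)
    then show "emeasure Q (G_set B) \<noteq> \<infinity>" by simp
    fix k n
    show "emeasure Q (residue_cyl B k n) = emeasure (scale_measure (emeasure Q (G_set B)) digit_haar) (residue_cyl B k n)"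
      using emeasure_cyl[OF setsQ const, of k n]
        emeasure_cyl[OF sets_digit_haar emeasure_digit_haar_cyl, of k n]
      by (simp add: G1 ennreal_times_divide)
  qed
  then have "emeasure Q A = emeasure Q (G_set B) * emeasure digit_haar A" by (metis emeasure_scale_measure)
  moreover have "emeasure Q (G_set B) = emeasure digit_haar A"
    using Q[of "G_set B"] AG sets.top[of digit_haar] by (simp add: space_digit_haar Int_absorb2)
  ultimately have "emeasure digit_haar A = emeasure digit_haar A * emeasure digit_haar A" using Q[OF A] by simp
  then have "measure digit_haar A = measure digit_haar A * measure digit_haar A"
    by (metis enn2real_mult measure_def)
  then show ?thesis by simp
qed

end

section \<open>Windows in the space of two-sided 0-1 sequences\<close>

definition agree_on_window :: "nat \<Rightarrow> (int \<Rightarrow> bool) \<Rightarrow> (int \<Rightarrow> bool) \<Rightarrow> bool" where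
  "agree_on_window m x y \<longleftrightarrow> (\<forall>i\<in>{- int m..int m}. x i = y i)"

lemma agree_sym: "agree_on_window m x y \<Longrightarrow> agree_on_window m y x"
  by (simp add: agree_on_window_def)

lemma agree_trans: "agree_on_window m x y \<Longrightarrow> agree_on_window m y z \<Longrightarrow> agree_on_window m x z"
  by (simp add: agree_on_window_def)

lemma agree_refl: "agree_on_window m x x"
  by (simp add: agree_on_window_def)

lemma agree_mono: "m \<le> l \<Longrightarrow> agree_on_window l x y \<Longrightarrow> agree_on_window m x y"
  by (auto simp: agree_on_window_def)

lemma open_window_determined:
  assumes "\<And>x y. x \<in> A \<Longrightarrow> agree_on_window m x y \<Longrightarrow> y \<in> A"
  shows "open A"
proof -
  have eq: "A = (\<Union>x\<in>A. {y. \<forall>i\<in>{- int m..int m}. y i \<in> {x i}})"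
  proof (intro equalityI subsetI)
    fix y assume "y \<in> (\<Union>x\<in>A. {y. \<forall>i\<in>{- int m..int m}. y i \<in> {x i}})"
    then obtain x where "x \<in> A" "agree_on_window m x y" by (auto simp: agree_on_window_def)
    then show "y \<in> A" by (rule assms)
  qed blast
  have "open {b}" for b :: bool
    unfolding open_closed by (rule finite_imp_closed) simp
  then have op: "open {y::int \<Rightarrow> bool. \<forall>i\<in>{- int m..int m}. y i \<in> {x i}}" for x
    by (intro product_topology_basis') auto
  show ?thesis by (subst eq) (intro open_UN ballI op)
qed

lemma open_contains_window:
  assumes "open U" "x \<in> U"
  obtains m where "\<And>y. agree_on_window m x y \<Longrightarrow> y \<in> U"
proof -
  have "openin (product_topology (\<lambda>i. euclidean :: bool topology) UNIV) U"
    using assms(1) by (simp add: euclidean_product_topology)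
  then obtain V where V: "finite {i. V i \<noteq> UNIV}" "x \<in> Pi\<^sub>E UNIV V" "Pi\<^sub>E UNIV V \<subseteq> U"
    using assms(2) unfolding openin_product_topology_alt by auto
  have "finite (nat ` abs ` {i. V i \<noteq> UNIV})" using V(1) by simp
  then obtain m where m: "\<And>i. V i \<noteq> UNIV \<Longrightarrow> nat \<bar>i\<bar> \<le> m"
    unfolding finite_nat_set_iff_bounded_le by blast
  show ?thesis
  proof
    fix y assume y: "agree_on_window m x y"
    have "y i \<in> V i" for i
    proof (cases "V i = UNIV")
      case False
      then have "i \<in> {- int m..int m}" using m[of i] by auto
      then have "x i = y i" using y by (simp add: agree_on_window_def)
      moreover have "x i \<in> V i" using V(2) by (rule PiE_mem) simp
      ultimately show ?thesis by simp
    qed simp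
    then show "y \<in> U" using V(3) by (auto simp: PiE_iff)
  qed
qed

text \<open>
  The largest subset of \<open>U\<close> that depends only on the coordinates from \<open>- m\<close> to \<open>m\<close>. It is clopen, and an
  open set is the union of its cores.
\<close>

definition window_core :: "nat \<Rightarrow> (int \<Rightarrow> bool) set \<Rightarrow> (int \<Rightarrow> bool) set" where
  "window_core m U = {x. \<forall>y. agree_on_window m x y \<longrightarrow> y \<in> U}"

lemma window_core_determined: "x \<in> window_core m U \<Longrightarrow> agree_on_window m x y \<Longrightarrow> y \<in> window_core m U"
  unfolding window_core_def using agree_trans by blast

lemma window_core_subset: "window_core m U \<subseteq> U"
  using agree_refl by (auto simp: window_core_def)

lemma open_eq_Union_window_core:
  assumes "open U"
  shows "U = (\<Union>m. window_core m U)"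
proof (intro equalityI subsetI)
  fix x assume "x \<in> U"
  then obtain m where "\<And>y. agree_on_window m x y \<Longrightarrow> y \<in> U" using open_contains_window[OF assms] by metis
  then show "x \<in> (\<Union>m. window_core m U)" by (auto simp: window_core_def)
qed (use window_core_subset in blast)

lemma compact_bool_sequences: "compact (UNIV :: (int \<Rightarrow> bool) set)"
proof -
  have "compact_space (euclidean :: bool topology)"
    by (simp add: compact_space_def finite_imp_compact)
  then have "compact_space (product_topology (\<lambda>i::int. euclidean :: bool topology) UNIV)"
    by (simp add: compact_space_product_topology)
  then show ?thesis by (simp add: euclidean_product_topology compact_space_def)
qed

text \<open>
  Call a point good for \<open>m\<close> if \<open>f\<close> oscillates by less than \<open>e\<close> on the set of points that agree with it on the
  window of radius \<open>m\<close>. The sets of good points are open, increase with \<open>m\<close> and cover the compact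
  space.
\<close>

lemma continuous_uniform_window:
  fixes f :: "(int \<Rightarrow> bool) \<Rightarrow> real"
  assumes f: "continuous_on UNIV f" and e: "e > 0"
  obtains m where "\<And>x y. agree_on_window m x y \<Longrightarrow> \<bar>f x - f y\<bar> < e"
proof -
  define osc_core where "osc_core m = {x. \<forall>y z. agree_on_window m x y \<longrightarrow> agree_on_window m x z \<longrightarrow> \<bar>f y - f z\<bar> < e}" for m
  have op: "open (osc_core m)" for m
    by (rule open_window_determined[of _ m]) (unfold osc_core_def, blast intro: agree_trans)
  have mono: "osc_core m \<subseteq> osc_core l" if "m \<le> l" for m l
    using agree_mono[OF that] unfolding osc_core_def by blast
  have "x \<in> (\<Union>m. osc_core m)" for x
  proof -
    have "open {y. f y \<in> ball (f x) (e / 2)}"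
      using f open_vimage[of "ball (f x) (e / 2)" f] by (simp add: vimage_def)
    moreover have "x \<in> {y. f y \<in> ball (f x) (e / 2)}" using e by simp
    ultimately obtain m where m: "\<And>y. agree_on_window m x y \<Longrightarrow> y \<in> {y. f y \<in> ball (f x) (e / 2)}"
      using open_contains_window by metis
    have "\<bar>f y - f z\<bar> < e" if "agree_on_window m x y" "agree_on_window m x z" for y z
      using m[OF that(1)] m[OF that(2)] unfolding mem_Collect_eq mem_ball dist_real_def by linarith
    then show ?thesis by (auto simp: osc_core_def)
  qed
  then have "UNIV \<subseteq> (\<Union>m\<in>UNIV. osc_core m)" by blast
  then obtain M where M: "finite M" "UNIV \<subseteq> (\<Union>m\<in>M. osc_core m)"
    using compactE_image[OF compact_bool_sequences, of UNIV osc_core] op by metis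
  show ?thesis
  proof
    fix x y assume xy: "agree_on_window (Max (insert 0 M)) x y"
    obtain m where "m \<in> M" "x \<in> osc_core m" using M by blast
    then have "x \<in> osc_core (Max (insert 0 M))" using mono[of m "Max (insert 0 M)"] M(1) by auto
    then show "\<bar>f x - f y\<bar> < e" using xy agree_refl unfolding osc_core_def by blast
  qed
qed

text \<open>
  An open set is a countable union of sets that depend on a finite window, and there are only
  finitely many patterns on such a window.
\<close>

lemma measurable_bool_sequenceI:
  assumes "\<And>n. {w \<in> space M. f w n} \<in> sets M"
  shows "f \<in> measurable M (borel :: (int \<Rightarrow> bool) measure)"
proof (rule borel_measurableI)
  fix U :: "(int \<Rightarrow> bool) set" assume U: "open U"
  have eq: "{w \<in> space M. f w i = (i \<in> A)} \<in> sets M" for i :: int and A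
  proof (cases "i \<in> A")
    case False
    have "{w \<in> space M. f w i = (i \<in> A)} = space M - {w \<in> space M. f w i}" using False by auto
    then show ?thesis using assms by simp
  qed (use assms in simp)
  have "f -` window_core m U \<inter> space M \<in> sets M" for m
  proof -
    let ?I = "{- int m..int m}"
    have "f -` window_core m U \<inter> space M =
      (\<Union>A\<in>{A \<in> Pow ?I. (\<lambda>i. i \<in> A) \<in> window_core m U}. {w \<in> space M. \<forall>i\<in>?I. f w i = (i \<in> A)})"
      (is "?L = ?R")
    proof (intro equalityI subsetI)
      fix w assume w: "w \<in> ?L"
      let ?A = "{i \<in> ?I. f w i}"
      have "agree_on_window m (f w) (\<lambda>i. i \<in> ?A)" by (simp add: agree_on_window_def)
      then have "(\<lambda>i. i \<in> ?A) \<in> window_core m U" using w window_core_determined by blast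
      then show "w \<in> ?R" using w by (intro UN_I[of ?A]) auto
    next
      fix w assume "w \<in> ?R"
      then obtain A where A: "(\<lambda>i. i \<in> A) \<in> window_core m U" "w \<in> space M" "\<forall>i\<in>?I. f w i = (i \<in> A)"
        by blast
      then have "agree_on_window m (\<lambda>i. i \<in> A) (f w)" by (simp add: agree_on_window_def)
      then show "w \<in> ?L" using A window_core_determined by blast
    qed
    also have "\<dots> \<in> sets M"
      by (intro sets.finite_UN) (auto intro!: sets.sets_Collect_finite_All eq)
    finally show ?thesis .
  qed
  then have "(\<Union>m. f -` window_core m U \<inter> space M) \<in> sets M" by blast
  moreover have "(\<Union>m. f -` window_core m U \<inter> space M) = f -` U \<inter> space M"
    using open_eq_Union_window_core[OF U] by blast
  ultimately show "f -` U \<inter> space M \<in> sets M" by simp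
qed

lemma left_shift_measurable: "left_shift \<in> measurable borel borel"
proof (rule measurable_bool_sequenceI)
  fix n
  have "open {w. left_shift w n}"
  proof (rule open_window_determined[of _ "nat \<bar>n + 1\<bar>"])
    fix x y assume "x \<in> {w. left_shift w n}" "agree_on_window (nat \<bar>n + 1\<bar>) x y"
    moreover have "n + 1 \<in> {- int (nat \<bar>n + 1\<bar>)..int (nat \<bar>n + 1\<bar>)}" by auto
    ultimately show "y \<in> {w. left_shift w n}" by (simp add: agree_on_window_def left_shift_apply)
  qed
  then show "{w \<in> space borel. left_shift w n} \<in> sets borel" by simp
qed

section \<open>The Mirsky measure and the empirical measures of the free set\<close>

lemma eta_iff: "eta B n \<longleftrightarrow> (\<forall>b\<in>B. \<not> int b dvd n)"
  by (auto simp: eta_def free_set_def multiples_def dvd_def)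

lemma mirsky_map_iff: "mirsky_map B g n \<longleftrightarrow> (\<forall>b\<in>B. \<not> int b dvd n + g b)"
  by (simp add: mirsky_map_def cong_iff_dvd_diff)

lemma integral_empirical_measure:
  fixes f :: "(int \<Rightarrow> bool) \<Rightarrow> real"
  assumes "f \<in> borel_measurable borel"
  shows "integral\<^sup>L (empirical_measure left_shift x N) f = (\<Sum>n = 1..N. f (shift_by (int n) x)) / real N"
  unfolding empirical_measure_def using assms
  by (subst integral_distr)
    (auto simp: measurable_def sets_uniform_count_measure space_uniform_count_measure
      integral_uniform_count_measure funpow_left_shift)

definition free_nats :: "nat set \<Rightarrow> nat set" where
  "free_nats B = {n. eta B (int n)}"

lemma card_free_nats: "real (card (free_nats B \<inter> {1..N})) = (\<Sum>n = 1..N. of_bool (eta B (int n)))"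
  unfolding sum_indicator_eq_card[symmetric]
  by (intro sum.cong) (simp_all add: free_nats_def indicator_def)

context
  fixes B :: "nat set"
  assumes B0: "0 \<notin> B"
begin

abbreviation trunc :: "nat \<Rightarrow> nat set" where "trunc K \<equiv> B \<inter> {..K}"

lemma measurable_mirsky_map: "mirsky_map B \<in> measurable (haar_measure B) borel"
proof (rule measurable_bool_sequenceI)
  fix n
  have G: "haar_measure B = digit_haar B" by (rule haar_measure_eq[OF B0])
  have single: "{g \<in> G_set B. \<not> int b dvd n + g b} \<in> sets (digit_haar B)" if b: "b \<in> B" for b
  proof -
    have "{g \<in> G_set B. \<not> int b dvd n + g b} = (\<Union>m\<in>{m. \<not> int b dvd n + m}. residue_cyl B b m)"
      (is "?L = ?R")
    proof (intro equalityI subsetI)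
      fix g assume g: "g \<in> ?L"
      then obtain m where m: "g \<in> residue_cyl B b m" using in_cyl_obtain[OF B0] by blast
      then have "g b = m mod int b" using b by (auto simp: residue_cyl_def)
      then have "\<not> int b dvd n + m" using g by (auto simp: dvd_eq_mod_eq_0 mod_simps)
      then show "g \<in> ?R" using m by blast
    next
      fix g assume "g \<in> ?R"
      then obtain m where m: "\<not> int b dvd n + m" "g \<in> residue_cyl B b m" by blast
      then have "g b = m mod int b" using b by (auto simp: residue_cyl_def)
      then show "g \<in> ?L" using m by (auto simp: dvd_eq_mod_eq_0 mod_simps residue_cyl_def)
    qed
    also have "\<dots> \<in> sets (digit_haar B)"
      by (intro sets.countable_UN') (auto intro!: cyl_in_sets[OF B0 sets_digit_haar[OF B0]])
    finally show ?thesis .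
  qed
  have "{g \<in> space (digit_haar B). b \<in> B \<longrightarrow> \<not> int b dvd n + g b} \<in> sets (digit_haar B)" for b
  proof (cases "b \<in> B")
    case True
    then show ?thesis using single[OF True] by (simp add: space_digit_haar[OF B0])
  qed simp
  then have "{g \<in> space (digit_haar B). \<forall>b. b \<in> B \<longrightarrow> \<not> int b dvd n + g b} \<in> sets (digit_haar B)"
    by (rule sets.sets_Collect_countable_All)
  then show "{g \<in> space (haar_measure B). mirsky_map B g n} \<in> sets (haar_measure B)"
    by (simp add: G mirsky_map_iff Ball_def)
qed

lemma prob_space_haar: "prob_space (haar_measure B)"
  unfolding haar_measure_eq[OF B0] by (rule prob_space_digit_haar[OF B0])

lemma prob_space_mirsky: "prob_space (mirsky_measure B)"
  unfolding mirsky_measure_def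
  by (rule prob_space.prob_space_distr[OF prob_space_haar measurable_mirsky_map])

text \<open>
  A random point whose law is the Mirsky measure.
\<close>

definition random_point :: "(nat \<Rightarrow> nat) \<Rightarrow> int \<Rightarrow> bool" where
  "random_point w = mirsky_map B (profinite_residues B w)"

text \<open>
  A uniformly distributed point on the orbit of the periodic sequence for the moduli up to \<open>K\<close>, defined
  on the same probability space as \<open>random_point\<close>.
\<close>

definition random_point_trunc :: "nat \<Rightarrow> (nat \<Rightarrow> nat) \<Rightarrow> int \<Rightarrow> bool" where
  "random_point_trunc K w = shift_by (int (factoradic_prefix w K)) (eta (trunc K))"

lemma measurable_random_point: "random_point \<in> measurable factoradic_digits borel"
  and mirsky_measure_eq: "mirsky_measure B = distr factoradic_digits borel random_point"
proof -
  have 1: "profinite_residues B \<in> measurable factoradic_digits (haar_measure B)"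
  proof -
    have "sets (haar_measure B) = sets (sigma (G_set B) (residue_cyls B))"
      by (simp only: haar_measure_eq[OF B0] digit_haar_def[OF B0] sets_distr)
    then show ?thesis
      using measurable_profinite_residues[OF B0] measurable_cong_sets[OF refl] by blast
  qed
  show "random_point \<in> measurable factoradic_digits borel"
    unfolding random_point_def[abs_def] by (rule measurable_compose[OF 1 measurable_mirsky_map])
  have "distr factoradic_digits (sigma (G_set B) (residue_cyls B)) (profinite_residues B) =
      distr factoradic_digits (haar_measure B) (profinite_residues B)"
  proof (rule distr_cong)
    show "sets (sigma (G_set B) (residue_cyls B)) = sets (haar_measure B)"
      by (simp only: haar_measure_eq[OF B0] digit_haar_def[OF B0] sets_distr)
  qed simp_all
  then have "haar_measure B = distr factoradic_digits (haar_measure B) (profinite_residues B)"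
    by (simp only: haar_measure_eq[OF B0] digit_haar_def[OF B0])
  then have "mirsky_measure B = distr (distr factoradic_digits (haar_measure B) (profinite_residues B)) borel (mirsky_map B)"
    unfolding mirsky_measure_def by (rule arg_cong[where f = "\<lambda>P. distr P borel (mirsky_map B)"])
  also have "\<dots> = distr factoradic_digits borel (mirsky_map B \<circ> profinite_residues B)"
    by (rule distr_distr[OF measurable_mirsky_map 1])
  finally show "mirsky_measure B = distr factoradic_digits borel random_point" by (simp add: random_point_def[abs_def] comp_def)
qed

lemma random_point_iff: "random_point w n \<longleftrightarrow> (\<forall>b\<in>B. \<not> int b dvd n + int (factoradic_prefix w b))"
proof -
  have "int b dvd n + profinite_residues B w b \<longleftrightarrow> int b dvd n + int (factoradic_prefix w b)" if "b \<in> B" for b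
    using that by (simp add: profinite_residues_def[OF B0] dvd_eq_mod_eq_0 mod_simps)
  then show ?thesis unfolding random_point_def mirsky_map_iff by blast
qed

lemma random_point_trunc_iff: "random_point_trunc K w n \<longleftrightarrow> (\<forall>b\<in>B. b \<le> K \<longrightarrow> \<not> int b dvd n + int (factoradic_prefix w b))"
proof -
  have "int b dvd n + int (factoradic_prefix w K) \<longleftrightarrow> int b dvd n + int (factoradic_prefix w b)" if "b \<in> B" "b \<le> K" for b
    using factoradic_prefix_mod_B[OF B0 that, of w] by (metis dvd_eq_mod_eq_0 mod_add_right_eq)
  then show ?thesis unfolding random_point_trunc_def shift_by_def eta_iff by auto
qed

lemma random_point_imp_trunc: "random_point w n \<Longrightarrow> random_point_trunc K w n"
  by (simp add: random_point_iff random_point_trunc_iff)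

text \<open>
  As \<open>K\<close> grows the coordinate can only change from true to false, and it does so as soon as one
  modulus divides.
\<close>

lemma eventually_trunc_eq: "\<forall>\<^sub>F K in sequentially. random_point_trunc K w n = random_point w n"
proof (cases "random_point w n")
  case False
  then obtain b where "b \<in> B" "int b dvd n + int (factoradic_prefix w b)" by (auto simp: random_point_iff)
  then have "\<not> random_point_trunc K w n" if "K \<ge> b" for K using that by (auto simp: random_point_trunc_iff)
  then show ?thesis using False by (auto simp: eventually_sequentially)
qed (simp add: random_point_imp_trunc)

lemma eventually_agree_trunc: "\<forall>\<^sub>F K in sequentially. agree_on_window m (random_point w) (random_point_trunc K w)"
  unfolding agree_on_window_def
  by (rule eventually_ball_finite) (auto intro: eventually_mono[OF eventually_trunc_eq])

lemma continuous_trunc_tendsto: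
  fixes f :: "(int \<Rightarrow> bool) \<Rightarrow> real"
  assumes "continuous_on UNIV f"
  shows "(\<lambda>K. f (random_point_trunc K w)) \<longlonglongrightarrow> f (random_point w)"
proof (rule tendstoI)
  fix e :: real assume "e > 0"
  then obtain m where m: "\<And>x y. agree_on_window m x y \<Longrightarrow> \<bar>f x - f y\<bar> < e"
    using continuous_uniform_window[OF assms] by metis
  show "\<forall>\<^sub>F K in sequentially. dist (f (random_point_trunc K w)) (f (random_point w)) < e"
    using eventually_agree_trunc[of m w]
    by eventually_elim (use m in \<open>simp add: dist_real_def abs_minus_commute\<close>)
qed

lemma integral_random_point_trunc:
  fixes f :: "(int \<Rightarrow> bool) \<Rightarrow> real"
  shows "integral\<^sup>L factoradic_digits (\<lambda>w. f (random_point_trunc K w)) = (\<Sum>v<fact K. f (shift_by (int v) (eta (trunc K)))) / fact K"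
  unfolding random_point_trunc_def by (rule integral_factoradic_prefix)

lemma integral_trunc_tendsto:
  fixes f :: "(int \<Rightarrow> bool) \<Rightarrow> real"
  assumes f: "continuous_on UNIV f" "bounded (range f)"
  shows "(\<lambda>K. (\<Sum>v<fact K. f (shift_by (int v) (eta (trunc K)))) / fact K)
    \<longlonglongrightarrow> integral\<^sup>L (mirsky_measure B) f"
proof -
  interpret D: prob_space factoradic_digits by (rule prob_space_factoradic_digits)
  obtain M where M: "\<And>x. \<bar>f x\<bar> \<le> M" using f(2) by (auto simp: bounded_iff)
  have fm: "f \<in> borel_measurable borel" using f(1) by (rule borel_measurable_continuous_onI)
  have "(\<lambda>K. integral\<^sup>L factoradic_digits (\<lambda>w. f (random_point_trunc K w))) \<longlonglongrightarrow> integral\<^sup>L factoradic_digits (\<lambda>w. f (random_point w))"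
  proof (rule integral_dominated_convergence[where w = "\<lambda>_. M"])
    show "(\<lambda>w. f (random_point w)) \<in> borel_measurable factoradic_digits"
      by (rule measurable_compose[OF measurable_random_point fm])
    show "(\<lambda>w. f (random_point_trunc K w)) \<in> borel_measurable factoradic_digits" for K
      unfolding random_point_trunc_def by (rule measurable_compose[OF measurable_factoradic_prefix]) simp
  qed (use M continuous_trunc_tendsto[OF f(1)] in auto)
  also have "integral\<^sup>L factoradic_digits (\<lambda>w. f (random_point w)) = integral\<^sup>L (mirsky_measure B) f"
    unfolding mirsky_measure_eq by (rule integral_distr[OF measurable_random_point fm, symmetric])
  finally show ?thesis by (simp add: integral_random_point_trunc)
qed

lemma eta_trunc_periodic: "eta (trunc K) (z + int (fact K)) = eta (trunc K) z"
proof -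
  have "int b dvd z + int (fact K) \<longleftrightarrow> int b dvd z" if "b \<in> trunc K" for b
  proof -
    have "b dvd fact K" using that B_pos[OF B0, of b] by (intro dvd_fact) auto
    then have "int b dvd int (fact K)" by (simp only: of_nat_dvd_iff)
    then show ?thesis by (rule dvd_add_left_iff)
  qed
  then show ?thesis unfolding eta_iff by blast
qed

lemma average_eta_trunc_tendsto:
  fixes f :: "(int \<Rightarrow> bool) \<Rightarrow> real"
  shows "(\<lambda>N. (\<Sum>n = 1..N. f (shift_by (int n) (eta (trunc K)))) / real N)
    \<longlonglongrightarrow> (\<Sum>v<fact K. f (shift_by (int v) (eta (trunc K)))) / fact K"
proof -
  have "shift_by (z + int (fact K)) (eta (trunc K)) = shift_by z (eta (trunc K))" for z
    unfolding shift_by_def using eta_trunc_periodic[of K] by (metis (no_types, opaque_lifting) add.assoc)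
  then show ?thesis
    using periodic_average_tendsto[of "\<lambda>z. f (shift_by z (eta (trunc K)))" "fact K"] by simp
qed

text \<open>
  The limit of the densities of the truncated free sets. As an integral against the Mirsky measure it
  comes with the convergence of these densities.
\<close>

definition free_density :: real where
  "free_density = integral\<^sup>L (mirsky_measure B) (\<lambda>x. of_bool (x 0))"

text \<open>
  The density of the free set of the moduli up to \<open>K\<close>, as an average over the period \<open>K!\<close>.
\<close>

definition trunc_density :: "nat \<Rightarrow> real" where
  "trunc_density K = (\<Sum>v<fact K. of_bool (eta (trunc K) (int v))) / fact K"

lemma continuous_coordinate: "continuous_on UNIV (\<lambda>x::int \<Rightarrow> bool. of_bool (x 0) :: real)"
proof (rule continuous_on_open_vimage[THEN iffD2, rule_format])
  fix V :: "real set"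
  have "open ((\<lambda>x::int \<Rightarrow> bool. of_bool (x 0) :: real) -` V)"
    by (rule open_window_determined[of _ 0]) (auto simp: agree_on_window_def)
  then show "open ((\<lambda>x::int \<Rightarrow> bool. of_bool (x 0) :: real) -` V \<inter> UNIV)" by simp
qed simp

lemma trunc_density_tendsto: "trunc_density \<longlonglongrightarrow> free_density"
proof -
  have "bounded (range (\<lambda>x::int \<Rightarrow> bool. of_bool (x 0) :: real))"
    by (rule boundedI[of _ 1]) auto
  from integral_trunc_tendsto[OF continuous_coordinate this]
  show ?thesis by (simp add: trunc_density_def[abs_def] free_density_def shift_by_def)
qed

lemma free_density_le: "free_density \<le> trunc_density K"
proof -
  interpret D: prob_space factoradic_digits by (rule prob_space_factoradic_digits)
  have fm: "(\<lambda>x::int \<Rightarrow> bool. of_bool (x 0) :: real) \<in> borel_measurable borel"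
    using continuous_coordinate by (rule borel_measurable_continuous_onI)
  have "free_density = integral\<^sup>L factoradic_digits (\<lambda>w. of_bool (random_point w 0))"
    unfolding free_density_def mirsky_measure_eq by (rule integral_distr[OF measurable_random_point fm])
  also have "\<dots> \<le> integral\<^sup>L factoradic_digits (\<lambda>w. of_bool (random_point_trunc K w 0))"
  proof (rule integral_mono)
    show "integrable factoradic_digits (\<lambda>w. of_bool (random_point w 0) :: real)"
      by (rule D.integrable_const_bound[where B = 1])
        (auto intro!: measurable_compose[OF measurable_random_point fm])
    have "(\<lambda>w. of_bool (random_point_trunc K w 0) :: real) \<in> borel_measurable factoradic_digits"
      unfolding random_point_trunc_def by (rule measurable_compose[OF measurable_factoradic_prefix]) simp
    then show "integrable factoradic_digits (\<lambda>w. of_bool (random_point_trunc K w 0) :: real)"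
      by (intro D.integrable_const_bound[where B = 1]) auto
    show "of_bool (random_point w 0) \<le> (of_bool (random_point_trunc K w 0) :: real)" for w
      using random_point_imp_trunc[of w 0 K] by simp
  qed
  also have "\<dots> = trunc_density K"
    using integral_random_point_trunc[of "\<lambda>x. of_bool (x 0)" K] by (simp add: trunc_density_def shift_by_def)
  finally show ?thesis .
qed

lemma card_free_trunc_tendsto:
  "(\<lambda>N. real (card (free_nats (trunc K) \<inter> {1..N})) / real N) \<longlonglongrightarrow> trunc_density K"
  unfolding card_free_nats trunc_density_def
  using average_eta_trunc_tendsto[of "\<lambda>x. of_bool (x 0)" K, unfolded shift_by_def add_0] .

lemma eta_imp_eta_trunc: "eta B n \<Longrightarrow> eta (trunc K) n"
  by (auto simp: eta_iff)

lemma card_free_le: "card (free_nats B \<inter> {1..N}) \<le> card (free_nats (trunc K) \<inter> {1..N})"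
  by (rule card_mono) (auto simp: free_nats_def eta_imp_eta_trunc)

text \<open>
  The truncated free sets are periodic, so their counting functions deviate boundedly from their
  densities, and a modulus greater than \<open>K\<close> has no positive multiple up to \<open>K\<close>.
\<close>

lemma frequently_card_free_gt:
  assumes "c < free_density"
  shows "\<exists>N\<ge>N0. c * real N < real (card (free_nats B \<inter> {1..N}))"
proof (rule davenport_erdos[where E = "\<lambda>K. free_nats (trunc K)" and d = free_density])
  show "divisor_closed (free_nats (trunc K))" for K
    unfolding divisor_closed_def free_nats_def eta_iff mem_Collect_eq of_nat_mult
    by (blast intro: dvd_mult)
  show "\<exists>C. \<forall>N. free_density * real N - C \<le> real (card (free_nats (trunc K) \<inter> {1..N}))" for K
  proof -
    obtain C where C: "\<And>N. \<bar>(\<Sum>n = 1..N. of_bool (eta (trunc K) (int n))) - real N * trunc_density K\<bar> \<le> C"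
      using periodic_sum_bounded[of "\<lambda>z. of_bool (eta (trunc K) z)" "fact K"] eta_trunc_periodic[of K]
      by (auto simp: trunc_density_def)
    have "free_density * real N - C \<le> real (card (free_nats (trunc K) \<inter> {1..N}))" for N
      using C[of N] mult_right_mono[OF free_density_le[of K], of "real N"]
      unfolding card_free_nats by (simp add: mult.commute abs_le_iff)
    then show ?thesis by blast
  qed
  show "free_nats B \<inter> {1..K} = free_nats (trunc K) \<inter> {1..K}" for K
  proof -
    have "eta (trunc K) (int n) \<Longrightarrow> eta B (int n)" if "n \<in> {1..K}" for n
    proof -
      have "b \<le> K" if "int b dvd int n" for b
        using that \<open>n \<in> {1..K}\<close> dvd_imp_le[of b n] by auto
      then show "eta (trunc K) (int n) \<Longrightarrow> eta B (int n)" by (auto simp: eta_iff)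
    qed
    then show ?thesis using eta_imp_eta_trunc by (auto simp: free_nats_def)
  qed
qed (rule assms)

text \<open>
  Where the shifted points agree on the window, the values of \<open>f\<close> differ by less than \<open>e\<close>; elsewhere they
  differ by at most \<open>2 * M\<close>. A disagreement of the shifts by \<open>n\<close> occurs at some position \<open>n + i\<close> with
  \<open>\<bar>i\<bar> \<le> m\<close>, and for each of the \<open>2 * m + 1\<close> values of \<open>i\<close> the number of such \<open>n \<le> N\<close> is the difference of
  the two counting functions, up to the boundary error \<open>m\<close>.
\<close>

lemma average_difference_bound:
  fixes f :: "(int \<Rightarrow> bool) \<Rightarrow> real"
  assumes M: "\<And>x. \<bar>f x\<bar> \<le> M" and m: "\<And>x y. agree_on_window m x y \<Longrightarrow> \<bar>f x - f y\<bar> < e"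
    and e: "e > 0" and N: "N > 0"
  shows "\<bar>(\<Sum>n = 1..N. f (shift_by (int n) (eta B))) / real N
      - (\<Sum>n = 1..N. f (shift_by (int n) (eta (trunc K)))) / real N\<bar>
    \<le> e + 2 * M * real (2 * m + 1) * (real (card (free_nats (trunc K) \<inter> {1..N})) / real N
        - real (card (free_nats B \<inter> {1..N})) / real N + real m / real N)"
proof -
  define g :: "int \<Rightarrow> real" where "g z = of_bool (eta (trunc K) z) - of_bool (eta B z)" for z
  have g: "0 \<le> g z" "g z \<le> 1" for z using eta_imp_eta_trunc[of z K] by (auto simp: g_def)
  have M0: "M \<ge> 0" using M[of undefined] by linarith
  let ?I = "{- int m..int m}"
  let ?x = "\<lambda>n. shift_by (int n) (eta B)" and ?y = "\<lambda>n. shift_by (int n) (eta (trunc K))"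
  have pointwise: "\<bar>f (?x n) - f (?y n)\<bar> \<le> e + 2 * M * (\<Sum>i\<in>?I. g (int n + i))" for n
  proof (cases "agree_on_window m (?x n) (?y n)")
    case True
    have "0 \<le> 2 * M * (\<Sum>i\<in>?I. g (int n + i))" using M0 g by (intro mult_nonneg_nonneg sum_nonneg) auto
    then show ?thesis using m[OF True] by linarith
  next
    case False
    then obtain i where i: "i \<in> ?I" "eta B (i + int n) \<noteq> eta (trunc K) (i + int n)"
      unfolding agree_on_window_def shift_by_def by blast
    then have "g (int n + i) = 1" using eta_imp_eta_trunc[of "i + int n" K] by (auto simp: g_def add.commute)
    then have "1 \<le> (\<Sum>i\<in>?I. g (int n + i))"
      using member_le_sum[of i ?I "\<lambda>i. g (int n + i)"] i g by auto
    then have "2 * M \<le> 2 * M * (\<Sum>i\<in>?I. g (int n + i))"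
      using mult_left_mono[of 1 _ "2 * M"] M0 by simp
    moreover have "\<bar>f (?x n) - f (?y n)\<bar> \<le> 2 * M" using M[of "?x n"] M[of "?y n"] by linarith
    ultimately show ?thesis using e by linarith
  qed
  let ?D = "real (card (free_nats (trunc K) \<inter> {1..N})) - real (card (free_nats B \<inter> {1..N}))"
  have "(\<Sum>n = 1..N. \<Sum>i\<in>?I. g (int n + i)) = (\<Sum>i\<in>?I. \<Sum>n = 1..N. g (int n + i))"
    by (rule sum.swap)
  also have "\<dots> \<le> (\<Sum>i\<in>?I. ?D + real m)"
  proof (rule sum_mono)
    fix i assume i: "i \<in> ?I"
    have "(\<Sum>n = 1..N. g (int n)) = ?D"
      unfolding card_free_nats by (simp add: g_def sum_subtractf)
    moreover have "\<bar>real_of_int i\<bar> \<le> real m" using i by auto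
    ultimately show "(\<Sum>n = 1..N. g (int n + i)) \<le> ?D + real m"
      using sum_shift_le[where g = g and N = N and i = i, OF g] by linarith
  qed
  also have "\<dots> = real (2 * m + 1) * (?D + real m)" by simp
  finally have G: "(\<Sum>n = 1..N. \<Sum>i\<in>?I. g (int n + i)) \<le> real (2 * m + 1) * (?D + real m)" .
  have "\<bar>(\<Sum>n = 1..N. f (?x n)) - (\<Sum>n = 1..N. f (?y n))\<bar> \<le> (\<Sum>n = 1..N. \<bar>f (?x n) - f (?y n)\<bar>)"
    unfolding sum_subtractf[symmetric] by (rule sum_abs)
  also have "\<dots> \<le> (\<Sum>n = 1..N. e + 2 * M * (\<Sum>i\<in>?I. g (int n + i)))"
    by (rule sum_mono) (rule pointwise)
  also have "\<dots> = real N * e + 2 * M * (\<Sum>n = 1..N. \<Sum>i\<in>?I. g (int n + i))"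
    by (simp add: sum.distrib sum_distrib_left)
  also have "\<dots> \<le> real N * e + 2 * M * (real (2 * m + 1) * (?D + real m))"
    using M0 G by (intro add_left_mono mult_left_mono) auto
  finally have "\<bar>(\<Sum>n = 1..N. f (?x n)) - (\<Sum>n = 1..N. f (?y n))\<bar> / real N
      \<le> (real N * e + 2 * M * (real (2 * m + 1) * (?D + real m))) / real N"
    by (rule divide_right_mono) simp
  also have "\<dots> = e + 2 * M * real (2 * m + 1) * (real (card (free_nats (trunc K) \<inter> {1..N})) / real N
        - real (card (free_nats B \<inter> {1..N})) / real N + real m / real N)"
    using N by (simp add: field_simps)
  finally show ?thesis using N by (simp add: diff_divide_distrib[symmetric] abs_divide)
qed

text \<open>
  Given a tolerance, first choose the window of \<open>f\<close>, then \<open>K\<close> so large that the truncated integral is close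
  to the integral of \<open>f\<close> and the density of disagreements is small, and finally go far along \<open>t\<close>.
\<close>

lemma weakly_converges_along:
  assumes t: "filterlim t at_top sequentially"
    and dens: "(\<lambda>k. real (card (free_nats B \<inter> {1..t k})) / real (t k)) \<longlonglongrightarrow> free_density"
  shows "weakly_converges (\<lambda>k. empirical_measure left_shift (eta B) (t k)) (mirsky_measure B)"
  unfolding weakly_converges_def
proof (intro allI impI)
  fix f :: "(int \<Rightarrow> bool) \<Rightarrow> real"
  assume f: "continuous_on UNIV f \<and> bounded (range f)"
  then have fm: "f \<in> borel_measurable borel" by (blast intro: borel_measurable_continuous_onI)
  obtain M where M: "\<And>x. \<bar>f x\<bar> \<le> M" using f by (auto simp: bounded_iff)
  let ?avg = "\<lambda>x N. (\<Sum>n = 1..N. f (shift_by (int n) x)) / real N"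
  let ?E = "\<lambda>K. (\<Sum>v<fact K. f (shift_by (int v) (eta (trunc K)))) / fact K"
  let ?nu = "integral\<^sup>L (mirsky_measure B) f"
  have "(\<lambda>k. ?avg (eta B) (t k)) \<longlonglongrightarrow> ?nu"
  proof (rule tendstoI)
    fix r :: real assume r: "r > 0"
    define e where "e = r / 4"
    have e: "e > 0" using r by (simp add: e_def)
    obtain m where m: "\<And>x y. agree_on_window m x y \<Longrightarrow> \<bar>f x - f y\<bar> < e"
      using continuous_uniform_window[of f e] f e by metis
    let ?c = "2 * M * real (2 * m + 1)"
    have "\<forall>\<^sub>F K in sequentially. \<bar>?E K - ?nu\<bar> < e"
      using tendstoD[OF integral_trunc_tendsto[of f] e] f by (simp add: dist_real_def)
    moreover have "(\<lambda>K. ?c * (trunc_density K - free_density)) \<longlonglongrightarrow> ?c * (free_density - free_density)"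
      by (intro tendsto_intros trunc_density_tendsto)
    then have "\<forall>\<^sub>F K in sequentially. ?c * (trunc_density K - free_density) < e"
      using e by (intro order_tendstoD) auto
    ultimately have "\<forall>\<^sub>F K in sequentially. \<bar>?E K - ?nu\<bar> < e \<and> ?c * (trunc_density K - free_density) < e"
      by (rule eventually_conj)
    then obtain K where K: "\<bar>?E K - ?nu\<bar> < e" "?c * (trunc_density K - free_density) < e"
      using eventually_happens'[of sequentially] by auto
    let ?bd = "\<lambda>N. e + ?c * (real (card (free_nats (trunc K) \<inter> {1..N})) / real N
        - real (card (free_nats B \<inter> {1..N})) / real N + real m / real N)"
    have "(\<lambda>k. ?bd (t k)) \<longlonglongrightarrow> e + ?c * (trunc_density K - free_density + 0)"
      by (intro tendsto_intros dens filterlim_compose[OF card_free_trunc_tendsto t]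
          filterlim_compose[OF lim_const_over_n t])
    then have "\<forall>\<^sub>F k in sequentially. ?bd (t k) < 2 * e"
      using K(2) by (intro order_tendstoD) auto
    moreover have "\<forall>\<^sub>F k in sequentially. \<bar>?avg (eta (trunc K)) (t k) - ?E K\<bar> < e"
      using tendstoD[OF filterlim_compose[OF average_eta_trunc_tendsto t] e] by (simp add: dist_real_def)
    moreover have "\<forall>\<^sub>F k in sequentially. t k > 0"
      using t[unfolded filterlim_at_top, rule_format, of 1] by eventually_elim simp
    ultimately show "\<forall>\<^sub>F k in sequentially. dist (?avg (eta B) (t k)) ?nu < r"
    proof eventually_elim
      case (elim k)
      have "\<bar>?avg (eta B) (t k) - ?avg (eta (trunc K)) (t k)\<bar> \<le> ?bd (t k)"
        by (rule average_difference_bound[OF M m e elim(3)])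
      then show ?case using elim K(1) unfolding dist_real_def e_def by linarith
    qed
  qed
  then show "(\<lambda>k. integral\<^sup>L (empirical_measure left_shift (eta B) (t k)) f) \<longlonglongrightarrow> ?nu"
    by (simp add: integral_empirical_measure[OF fm])
qed

text \<open>
  The frequency of the free set is close to \<open>free_density\<close> from below at infinitely many places, by the
  Davenport--Erdos theorem, and it is asymptotically at most each truncated density.
\<close>

lemma density_achieving_sequence:
  obtains t :: "nat \<Rightarrow> nat" where "strict_mono t" "\<And>k. 1 \<le> t k"
    "(\<lambda>k. real (card (free_nats B \<inter> {1..t k})) / real (t k)) \<longlonglongrightarrow> free_density"
proof -
  let ?r = "\<lambda>N. real (card (free_nats B \<inter> {1..N})) / real N"
  define P where "P k N \<longleftrightarrow> 1 \<le> N \<and> free_density - 1 / real (Suc k) < ?r N" for k N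
  have ex: "\<exists>N>N0. P k N" for k N0
  proof -
    have "free_density - 1 / real (Suc k) < free_density" by simp
    then obtain N where N: "N \<ge> Suc N0" "(free_density - 1 / real (Suc k)) * real N < real (card (free_nats B \<inter> {1..N}))"
      using frequently_card_free_gt by blast
    then have "P k N" unfolding P_def by (simp add: pos_less_divide_eq)
    then show ?thesis using N(1) by (intro exI[of _ N]) auto
  qed
  obtain t where t: "\<And>k. P k (t k)" "\<And>k. t k < t (Suc k)"
    using dependent_nat_choice[of P "\<lambda>_ N N'. N < N'"] ex by metis
  have sm: "strict_mono t" using t(2) by (simp add: strict_mono_Suc_iff)
  have lim: "(\<lambda>k. ?r (t k)) \<longlonglongrightarrow> free_density"
  proof (rule order_tendstoI)
    fix a assume a: "a < free_density"
    have "(\<lambda>k. free_density - 1 / real (Suc k)) \<longlonglongrightarrow> free_density - 0"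
      by (intro tendsto_intros LIMSEQ_Suc[OF lim_1_over_n])
    then have "\<forall>\<^sub>F k in sequentially. a < free_density - 1 / real (Suc k)"
      using a by (intro order_tendstoD) auto
    then show "\<forall>\<^sub>F k in sequentially. a < ?r (t k)"
    proof eventually_elim
      case (elim k)
      then show ?case using t(1)[of k] unfolding P_def by linarith
    qed
  next
    fix a assume "a > free_density"
    then have "\<forall>\<^sub>F K in sequentially. trunc_density K < a"
      using trunc_density_tendsto by (intro order_tendstoD)
    then obtain K where "trunc_density K < a" using eventually_happens'[of sequentially] by auto
    then have "\<forall>\<^sub>F k in sequentially. real (card (free_nats (trunc K) \<inter> {1..t k})) / real (t k) < a"
      using filterlim_compose[OF card_free_trunc_tendsto filterlim_subseq[OF sm]] by (intro order_tendstoD)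
    then show "\<forall>\<^sub>F k in sequentially. ?r (t k) < a"
    proof eventually_elim
      case (elim k)
      have "?r (t k) \<le> real (card (free_nats (trunc K) \<inter> {1..t k})) / real (t k)"
        using card_free_le by (intro divide_right_mono) auto
      then show ?case using elim by linarith
    qed
  qed
  show ?thesis using that[OF sm _ lim] t(1) by (simp add: P_def)
qed

lemma besicovitch_imp_density:
  assumes "besicovitch B"
  shows "(\<lambda>N. real (card (free_nats B \<inter> {1..N})) / real N) \<longlonglongrightarrow> free_density"
proof -
  let ?r = "\<lambda>N. real (card (free_nats B \<inter> {1..N})) / real N"
  obtain e where e: "(\<lambda>N. real (card (multiples B \<inter> {1..int N})) / real N) \<longlonglongrightarrow> e"
    using assms by (auto simp: besicovitch_def convergent_def)
  have "real (card (multiples B \<inter> {1..int N})) + real (card (free_nats B \<inter> {1..N})) = real N" for N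
  proof -
    have "int ` (free_nats B \<inter> {1..N}) = {1..int N} - multiples B"
      by (force simp: free_nats_def eta_def free_set_def image_iff intro!: exI[of _ "nat _"] bexI[of _ "nat _"])
    then have "card (free_nats B \<inter> {1..N}) = card ({1..int N} - multiples B)"
      by (metis card_image inj_on_of_nat)
    moreover have "card (multiples B \<inter> {1..int N}) + card ({1..int N} - multiples B) = card {1..int N}"
    proof (subst card_Un_disjoint[symmetric])
      have "multiples B \<inter> {1..int N} \<union> ({1..int N} - multiples B) = {1..int N}" by blast
      then show "card (multiples B \<inter> {1..int N} \<union> ({1..int N} - multiples B)) = card {1..int N}" by simp
    qed auto
    ultimately show ?thesis by simp
  qed
  then have "?r N = 1 - real (card (multiples B \<inter> {1..int N})) / real N" if "N > 0" for N
    using that by (simp add: field_simps)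
  then have "\<forall>\<^sub>F N in sequentially. 1 - real (card (multiples B \<inter> {1..int N})) / real N = ?r N"
    by (intro eventually_mono[OF eventually_gt_at_top[of 0]]) simp
  moreover have "(\<lambda>N. 1 - real (card (multiples B \<inter> {1..int N})) / real N) \<longlonglongrightarrow> 1 - e"
    by (intro tendsto_intros e)
  ultimately have lim: "?r \<longlonglongrightarrow> 1 - e" by (rule Lim_transform_eventually[rotated])
  obtain t where t: "strict_mono t" "(\<lambda>k. ?r (t k)) \<longlonglongrightarrow> free_density"
    using density_achieving_sequence by metis
  have "(\<lambda>k. ?r (t k)) \<longlonglongrightarrow> 1 - e"
    using filterlim_compose[OF lim filterlim_subseq[OF t(1)]] .
  then have "1 - e = free_density" using t(2) by (rule LIMSEQ_unique)
  then show ?thesis using lim by simp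
qed

lemma mirsky_map_translate:
  assumes "g \<in> G_set B"
  shows "mirsky_map B (residues_of B 1 \<otimes>\<^bsub>G_group B\<^esub> g) = left_shift (mirsky_map B g)"
proof
  fix n
  have "int b dvd n + (residues_of B 1 \<otimes>\<^bsub>G_group B\<^esub> g) b \<longleftrightarrow> int b dvd n + 1 + g b" if "b \<in> B" for b
    using that by (simp add: mult_G_group[OF B0] residues_of_def dvd_eq_mod_eq_0 mod_simps add.assoc)
  then show "mirsky_map B (residues_of B 1 \<otimes>\<^bsub>G_group B\<^esub> g) n = left_shift (mirsky_map B g) n"
    by (simp add: left_shift_apply mirsky_map_iff)
qed

lemma invariant_mirsky: "invariant_measure left_shift (mirsky_measure B)"
  unfolding invariant_measure_def
proof (intro conjI ballI)
  show "prob_space (mirsky_measure B)" by (rule prob_space_mirsky)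
  show sets: "sets (mirsky_measure B) = sets borel" by (simp add: mirsky_measure_def)
  show "left_shift \<in> measurable (mirsky_measure B) (mirsky_measure B)"
    using left_shift_measurable measurable_cong_sets[OF sets sets] by simp
  fix A assume "A \<in> sets (mirsky_measure B)"
  then have A: "A \<in> sets borel" by (simp add: sets)
  define t where "t = (\<lambda>g. residues_of B 1 \<otimes>\<^bsub>G_group B\<^esub> g)"
  note G = haar_measure_eq[OF B0]
  note res = residues_of_in_G_set[OF B0]
  have sp: "space (haar_measure B) = G_set B" by (simp add: G space_digit_haar[OF B0])
  have tm: "t \<in> measurable (haar_measure B) (haar_measure B)" unfolding t_def G
    by (rule measurable_mult[OF B0 space_digit_haar[OF B0] sets_digit_haar[OF B0] res])
  have SA: "left_shift -` A \<in> sets borel" using measurable_sets[OF left_shift_measurable A] by simp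
  have "emeasure (mirsky_measure B) (left_shift -` A) =
      emeasure (haar_measure B) (mirsky_map B -` (left_shift -` A) \<inter> G_set B)"
    unfolding mirsky_measure_def by (simp add: emeasure_distr[OF measurable_mirsky_map SA] sp)
  also have "mirsky_map B -` (left_shift -` A) \<inter> G_set B = t -` (mirsky_map B -` A \<inter> G_set B) \<inter> G_set B"
    using mirsky_map_translate mult_closed[OF B0 res] by (auto simp: t_def)
  also have "emeasure (haar_measure B) \<dots> = emeasure (distr (haar_measure B) (haar_measure B) t) (mirsky_map B -` A \<inter> G_set B)"
    using measurable_sets[OF measurable_mirsky_map A] by (subst emeasure_distr[OF tm]) (auto simp: sp)
  also have "distr (haar_measure B) (haar_measure B) t = haar_measure B"
    unfolding t_def G by (rule digit_haar_distr_mult[OF B0 res])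
  also have "emeasure (haar_measure B) (mirsky_map B -` A \<inter> G_set B) = emeasure (mirsky_measure B) A"
    unfolding mirsky_measure_def by (simp add: emeasure_distr[OF measurable_mirsky_map A] sp)
  finally show "emeasure (mirsky_measure B) (left_shift -` A) = emeasure (mirsky_measure B) A" .
qed

lemma ergodic_mirsky: "ergodic_measure left_shift (mirsky_measure B)"
  unfolding ergodic_measure_def
proof (intro conjI ballI impI)
  show "invariant_measure left_shift (mirsky_measure B)" by (rule invariant_mirsky)
  fix A assume "A \<in> sets (mirsky_measure B)" and inv: "left_shift -` A = A"
  then have A: "A \<in> sets borel" by (simp add: mirsky_measure_def)
  note G = haar_measure_eq[OF B0]
  have sp: "space (haar_measure B) = G_set B" by (simp add: G space_digit_haar[OF B0])
  let ?A = "mirsky_map B -` A \<inter> G_set B"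
  have "?A \<in> sets (digit_haar B)" using measurable_sets[OF measurable_mirsky_map A] by (simp add: sp G[symmetric])
  moreover have "residues_of B 1 \<otimes>\<^bsub>G_group B\<^esub> g \<in> ?A \<longleftrightarrow> g \<in> ?A" if g: "g \<in> G_set B" for g
    using mirsky_map_translate[OF g] mult_closed[OF B0 residues_of_in_G_set[OF B0] g] g inv by auto
  ultimately have "measure (digit_haar B) ?A = 0 \<or> measure (digit_haar B) ?A = 1"
    by (rule digit_haar_ergodic[OF B0])
  moreover have "measure (mirsky_measure B) A = measure (digit_haar B) ?A"
    unfolding mirsky_measure_def by (simp add: measure_distr[OF measurable_mirsky_map A] sp G[symmetric])
  ultimately show "measure (mirsky_measure B) A = 0 \<or> measure (mirsky_measure B) A = 1" by simp
qed

lemma continuous_indicator_window_core: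
  "continuous_on UNIV (indicator (window_core m U) :: (int \<Rightarrow> bool) \<Rightarrow> real)"
proof (rule continuous_on_open_vimage[THEN iffD2, rule_format])
  fix V :: "real set"
  have "open ((indicator (window_core m U) :: (int \<Rightarrow> bool) \<Rightarrow> real) -` V)"
  proof (rule open_window_determined[of _ m])
    fix x y assume x: "x \<in> indicator (window_core m U) -` V" and "agree_on_window m x y"
    then have "x \<in> window_core m U \<longleftrightarrow> y \<in> window_core m U"
      using window_core_determined agree_sym by blast
    then show "y \<in> indicator (window_core m U) -` V" using x by (simp add: indicator_def)
  qed
  then show "open ((indicator (window_core m U) :: (int \<Rightarrow> bool) \<Rightarrow> real) -` V \<inter> UNIV)" by simp
qed simp

text \<open>
  The complement of \<open>X_eta B\<close> is the countable union of its window cores. The indicator of a core is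
  continuous and vanishes along the orbit of \<open>eta B\<close>, so its integral, a limit of orbit averages, is 0.
\<close>

lemma mirsky_X_eta: "measure (mirsky_measure B) (X_eta B) = 1"
proof -
  interpret P: prob_space "mirsky_measure B" by (rule prob_space_mirsky)
  have sets: "sets (mirsky_measure B) = sets borel" by (simp add: mirsky_measure_def)
  have space: "space (mirsky_measure B) = UNIV" by (simp add: mirsky_measure_def)
  let ?U = "- X_eta B"
  have U: "open ?U" by (simp add: X_eta_def open_Compl)
  obtain t where t: "strict_mono t"
    "(\<lambda>k. real (card (free_nats B \<inter> {1..t k})) / real (t k)) \<longlonglongrightarrow> free_density"
    using density_achieving_sequence by metis
  have wc: "weakly_converges (\<lambda>k. empirical_measure left_shift (eta B) (t k)) (mirsky_measure B)"
    by (rule weakly_converges_along[OF filterlim_subseq[OF t(1)] t(2)])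
  have null: "window_core m ?U \<in> null_sets (mirsky_measure B)" for m
  proof -
    let ?f = "indicator (window_core m ?U) :: (int \<Rightarrow> bool) \<Rightarrow> real"
    have op: "open (window_core m ?U)" by (rule open_window_determined) (rule window_core_determined)
    have "(\<lambda>k. integral\<^sup>L (empirical_measure left_shift (eta B) (t k)) ?f) \<longlonglongrightarrow> integral\<^sup>L (mirsky_measure B) ?f"
    proof (rule wc[unfolded weakly_converges_def, rule_format], rule conjI)
      show "bounded (range ?f)" by (rule boundedI[of _ 1]) (auto simp: indicator_def)
    qed (rule continuous_indicator_window_core)
    moreover have "integral\<^sup>L (empirical_measure left_shift (eta B) N) ?f = 0" for N
    proof -
      have "shift_by (int n) (eta B) \<notin> window_core m ?U" for n
        using window_core_subset[of m ?U] closure_subset[of "range (\<lambda>m. shift_by m (eta B))"]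
        by (auto simp: X_eta_def)
      then show ?thesis using op by (subst integral_empirical_measure) auto
    qed
    ultimately have "integral\<^sup>L (mirsky_measure B) ?f = 0" by (simp add: LIMSEQ_const_iff)
    then have "measure (mirsky_measure B) (window_core m ?U) = 0" by (simp add: space)
    then show ?thesis using op by (simp add: null_sets_def sets P.emeasure_eq_measure)
  qed
  have "?U \<in> null_sets (mirsky_measure B)"
    by (subst open_eq_Union_window_core[OF U]) (intro null_sets_UN null)
  then have "measure (mirsky_measure B) ?U = 0" by (rule measure_eq_0_null_sets)
  moreover have "X_eta B \<in> sets borel" by (simp add: X_eta_def)
  ultimately show ?thesis
    using P.prob_compl[of "X_eta B"] by (simp add: sets space Compl_eq_Diff_UNIV)
qed

end

theorem proposition5:
  fixes B :: "nat set"
  assumes "0 \<notin> B"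
  shows "quasi_generic_point left_shift (eta B) (mirsky_measure B)
    \<and> ergodic_measure left_shift (mirsky_measure B)
    \<and> measure (mirsky_measure B) (X_eta B) = 1
    \<and> (besicovitch B \<longrightarrow> generic_point left_shift (eta B) (mirsky_measure B))"
proof (intro conjI impI)
  obtain t where t: "strict_mono t" "\<And>k. 1 \<le> t k"
    "(\<lambda>k. real (card (free_nats B \<inter> {1..t k})) / real (t k)) \<longlonglongrightarrow> free_density B"
    using density_achieving_sequence[OF assms] by metis
  then have "weakly_converges (\<lambda>k. empirical_measure left_shift (eta B) (t k)) (mirsky_measure B)"
    using weakly_converges_along[OF assms filterlim_subseq[OF t(1)]] by blast
  then show "quasi_generic_point left_shift (eta B) (mirsky_measure B)"
    using t invariant_mirsky[OF assms] unfolding quasi_generic_point_def by blast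
next
  assume "besicovitch B"
  then show "generic_point left_shift (eta B) (mirsky_measure B)"
    using weakly_converges_along[OF assms filterlim_ident besicovitch_imp_density[OF assms]] invariant_mirsky[OF assms]
    unfolding generic_point_def by simp
qed (rule ergodic_mirsky[OF assms] mirsky_X_eta[OF assms])+

end
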